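(* Let $G=(V,E)$ be a graph and $T\subseteq V$ with $1\le |T|\le 3$. Then $E$ is independent in the 2-dimensional $T$-coincident rigidity matroid $\mathcal{R}_T(G)=\mathcal{R}_{2,T}(G)$ if and only if $G$ is strongly $T$-sparse.
   Context: Graphs are finite and simple. A realisation of $G=(V,E)$ in $\mathbb{R}^2$ is a map $p:V\to\mathbb{R}^2$. The rigidity matrix $R(G,p)$ is the $|E|\times 2|V|$ matrix in which the row of an edge $xy$ has $p(x)-p(y)$ in the two columns of $x$, $p(y)-p(x)$ in the two columns of $y$, and zeros elsewhere. For non-empty $T\subseteq V$ with a chosen reference vertex $t\in T$, a realisation $p$ is $T$-coincident if $p(x)=p(t)$ for all $x\in T$, and is a generic $T$-coincident realisation if moreover the coordinates of $p(x)$, $x\in V\setminus(T\setminus\{t\})$, are algebraically independent over $\mathbb{Q}$. The matroid $\mathcal{R}_{2,T}(G)$ on $E$ is the row matroid of $R(G,p)$ for any generic $T$-coincident realisation $p$ of $G$ in $\mathbb{R}^2$ (a set of edges is independent iff the corresponding rows are linearly independent; this does not depend on the choice of $p$). For $X\subseteq V$, $i_G(X)$ is the number of edges of $G$ with both ends in $X$; for a family $\mathcal{X}$ of subsets of $V$, $i_G(\mathcal{X})$ is the number of edges of $G$ with both ends in some common member of $\mathcal{X}$. For a non-empty set $S\subseteq V$ and $X\subseteq V$, put $\mathrm{val}_S(X)=2|X|-3$ if $X\not\subseteq S$ and $\mathrm{val}_S(X)=0$ if $X\subseteq S$. A non-empty family $\mathcal{H}=\{H_1,\dots,H_k\}$ of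 subsets of $V$ is $S$-compatible if $S$ is a proper subset of $H_i$ for every $i$; its $S$-value is $\mathrm{val}_S(\mathcal{H})=\sum_{i=1}^k(2|H_i\setminus S|-1)+2(|S|-1)$. The graph $G$ is $S$-sparse if $i_G(X)\le \mathrm{val}_S(X)$ for all $X\subseteq V$ with $|X|\ge 2$ and $i_G(\mathcal{H})\le\mathrm{val}_S(\mathcal{H})$ for all $S$-compatible families $\mathcal{H}$. The graph $G$ is strongly $T$-sparse if it is $S$-sparse for all $\emptyset\ne S\subseteq T$. *)

theory Defs
  imports "HOL-Analysis.Analysis" "HOL-Library.Poly_Mapping"
begin

definition simple_graph :: "'v set \<Rightarrow> 'v set set \<Rightarrow> bool" where
  "simple_graph V E \<longleftrightarrow> finite V \<and> (\<forall>e\<in>E. e \<subseteq> V \<and> card e = 2)"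


text \<open>
  Polynomials over the rationals in variables \<open>'i\<close> are finitely supported maps from
  monomials \<open>'i \<Rightarrow>\<^sub>0 nat\<close> (exponent vectors) to coefficients.
\<close>

definition eval_rat_mpoly :: "('i \<Rightarrow> real) \<Rightarrow> (('i \<Rightarrow>\<^sub>0 nat) \<Rightarrow>\<^sub>0 rat) \<Rightarrow> real" where
  "eval_rat_mpoly x q =
     (\<Sum>m\<in>Poly_Mapping.keys q. of_rat (Poly_Mapping.lookup q m) *
        (\<Prod>i\<in>Poly_Mapping.keys m. x i ^ Poly_Mapping.lookup m i))"

text \<open>
  Independence of the indexed family of the \<open>x i\<close> with \<open>i \<in> I\<close>; repeated values are
  therefore dependent.
\<close>

definition alg_indep_over_rat :: "'i set \<Rightarrow> ('i \<Rightarrow> real) \<Rightarrow> bool" where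
  "alg_indep_over_rat I x \<longleftrightarrow>
     (\<forall>q :: ('i \<Rightarrow>\<^sub>0 nat) \<Rightarrow>\<^sub>0 rat.
        (\<forall>m\<in>Poly_Mapping.keys q. Poly_Mapping.keys m \<subseteq> I) \<longrightarrow>
        eval_rat_mpoly x q = 0 \<longrightarrow> q = 0)"


text \<open>
  Rows are indexed by edges and columns by pairs of a vertex and a coordinate.
  For an edge \<open>e\<close> at \<open>v\<close>, the description picks the other end of \<open>e\<close>.
\<close>

definition rigidity_matrix :: "('v \<Rightarrow> real ^ 2) \<Rightarrow> 'v set \<Rightarrow> 'v \<times> 2 \<Rightarrow> real" where
  "rigidity_matrix p e = (\<lambda>(v, i). if v \<in> e then (p v - p (THE w. e = {v, w})) $ i else 0)"

text \<open>
  Linear independence of the rows \<open>M r\<close>, \<open>r \<in> R\<close>, as an indexed family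
  (equal rows with different indices are dependent), restricted to the columns in \<open>C\<close>.
\<close>

definition rows_independent :: "'r set \<Rightarrow> 'c set \<Rightarrow> ('r \<Rightarrow> 'c \<Rightarrow> real) \<Rightarrow> bool" where
  "rows_independent R C M \<longleftrightarrow>
     (\<forall>a :: 'r \<Rightarrow> real. (\<forall>c\<in>C. (\<Sum>r\<in>R. a r * M r c) = 0) \<longrightarrow> (\<forall>r\<in>R. a r = 0))"

text \<open>The row matroid of the rigidity matrix, given by its independent sets.\<close>

definition rigidity_matroid :: "'v set \<Rightarrow> 'v set set \<Rightarrow> ('v \<Rightarrow> real ^ 2) \<Rightarrow> 'v set set set" where
  "rigidity_matroid V E p =
     {F. F \<subseteq> E \<and> rows_independent F (V \<times> UNIV) (rigidity_matrix p)}"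

definition coincident_realisation :: "'v set \<Rightarrow> 'v \<Rightarrow> ('v \<Rightarrow> real ^ 2) \<Rightarrow> bool" where
  "coincident_realisation T t p \<longleftrightarrow> (\<forall>x\<in>T. p x = p t)"

text \<open>
  For \<open>p\<close> generic, \<open>rigidity_matroid V E p\<close> is the \<open>T\<close>-coincident rigidity matroid
  of the graph; it does not depend on the choice of \<open>p\<close>, nor on that of \<open>t \<in> T\<close>.
\<close>

definition generic_coincident_realisation ::
    "'v set \<Rightarrow> 'v set \<Rightarrow> 'v \<Rightarrow> ('v \<Rightarrow> real ^ 2) \<Rightarrow> bool" where
  "generic_coincident_realisation V T t p \<longleftrightarrow>
     coincident_realisation T t p \<and>
     alg_indep_over_rat ((V - (T - {t})) \<times> UNIV) (\<lambda>(x, i). p x $ i)"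


definition induced_edges :: "'v set set \<Rightarrow> 'v set \<Rightarrow> nat" where
  "induced_edges E X = card {e \<in> E. e \<subseteq> X}"

definition family_induced_edges :: "'v set set \<Rightarrow> 'v set set \<Rightarrow> nat" where
  "family_induced_edges E \<H> = card {e \<in> E. \<exists>X\<in>\<H>. e \<subseteq> X}"

text \<open>Values are integers, as \<open>2 * card X - 3\<close> is negative for a singleton.\<close>

definition set_val :: "'v set \<Rightarrow> 'v set \<Rightarrow> int" where
  "set_val S X = (if X \<subseteq> S then 0 else 2 * int (card X) - 3)"

definition compatible_family :: "'v set \<Rightarrow> 'v set \<Rightarrow> 'v set set \<Rightarrow> bool" where
  "compatible_family V S \<H> \<longleftrightarrow> \<H> \<noteq> {} \<and> (\<forall>H\<in>\<H>. H \<subseteq> V \<and> S \<subset> H)"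

definition family_val :: "'v set \<Rightarrow> 'v set set \<Rightarrow> int" where
  "family_val S \<H> = (\<Sum>H\<in>\<H>. 2 * int (card (H - S)) - 1) + 2 * (int (card S) - 1)"

definition S_sparse :: "'v set \<Rightarrow> 'v set set \<Rightarrow> 'v set \<Rightarrow> bool" where
  "S_sparse V E S \<longleftrightarrow>
     (\<forall>X. X \<subseteq> V \<longrightarrow> card X \<ge> 2 \<longrightarrow> int (induced_edges E X) \<le> set_val S X) \<and>
     (\<forall>\<H>. compatible_family V S \<H> \<longrightarrow> int (family_induced_edges E \<H>) \<le> family_val S \<H>)"

definition strongly_sparse :: "'v set \<Rightarrow> 'v set set \<Rightarrow> 'v set \<Rightarrow> bool" where
  "strongly_sparse V E T \<longleftrightarrow> (\<forall>S. S \<noteq> {} \<longrightarrow> S \<subseteq> T \<longrightarrow> S_sparse V E S)"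

end

theory Submission
  imports Defs "HOL-Library.Function_Algebras"
begin

text \<open>
  The row of an edge \<open>xy\<close> is read as a load on the vertices: opposite forces at \<open>x\<close> and \<open>y\<close> along the
  line through \<open>p x\<close> and \<open>p y\<close>.  All rows of edges inside a vertex set \<open>X\<close> lie in the space
  \<open>eq_loads p X\<close> of loads on \<open>X\<close> with zero resultant and zero moment.  If \<open>p\<close> is not constant on \<open>X\<close>,
  levers show that this space has dimension at most \<open>2 * card X - 3\<close>; if \<open>p\<close> is constant on \<open>S\<close>, it consists
  of all loads on \<open>S\<close> with zero sum and has dimension at most \<open>2 * (card S - 1)\<close>.  Combining the two, the loads
  on those members of an \<open>S\<close>-compatible family on which \<open>p\<close> is not constant span at most \<open>family_val S\<close> dimensions.  So the rows of
  an edge set can be independent at a realisation coincident on \<open>T\<close> only if the set is strongly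
  sparse (\<open>indep_imp_strongly_sparse\<close>).

  For the converse, genericity enters through \<open>rows_independent_at_generic_point\<close>: an edge set that
  is independent at some realisation coincident on \<open>T\<close> is independent at \<open>p\<close>.  The proof is by
  induction on the number of vertices (\<open>strongly_sparse_imp_indep\<close>).  Suppose that \<open>E\<close> is strongly
  sparse but dependent, and let \<open>v\<close> be a vertex and \<open>F\<close> the set of edges avoiding \<open>v\<close>, which is
  independent by induction.  Were \<open>v\<close> of degree at most two with at most one vertex of \<open>T\<close> among it and
  its neighbours, \<open>E\<close> would be independent as well.  If \<open>v\<close> is outside \<open>T\<close> and has degree three and at
  most one neighbour in \<open>T\<close>, putting \<open>v\<close> at the midpoint of two neighbours shows that the rows of all
  three edges between the neighbours are spanned by \<open>F\<close>.  If \<open>v\<close> is outside \<open>T\<close> and has degree at most three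
  and exactly two neighbours \<open>r, s\<close> in \<open>T\<close>, then \<open>E\<close> is independent unless \<open>F\<close> spans all pairs of opposite forces
  at \<open>r\<close> and \<open>s\<close>.  Both conclusions say that certain equilibrium loads are resolved by \<open>F\<close>, and the
  tightness result described next turns each of them into a violation of sparsity by \<open>E\<close>.
  Hence vertices in \<open>T\<close> have degree at least three, and the other ones
  have degree at least four, except for vertices of degree three joined to all of \<open>T\<close>.  Sparsity
  allows at most two of these exceptions, and \<open>card T \<le> 3\<close>, so the sum of the degrees is at least
  \<open>4 * card U - 5\<close> on the current vertex set \<open>U\<close>.  This contradicts \<open>card E \<le> 2 * card U - 3\<close>.

  The tightness result (\<open>components_tight\<close>) describes what an independent sparse \<open>F\<close> spans.  Let \<open>S\<close> be
  the largest subset of \<open>T\<close> all of whose equilibrium loads are resolved by \<open>F\<close>; it contains every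
  such subset with two or more elements because two disjoint ones would need four vertices in \<open>T\<close>.  Call a set rigid
  if \<open>F\<close> resolves all its equilibrium loads; two rigid sets sharing two points that \<open>p\<close> separates have a
  rigid union.  Choose in every maximal rigid set a Laman basis that uses only one vertex of \<open>S\<close>.  If the
  union of these bases were dependent, a circuit \<open>C\<close> in it would violate sparsity by the induction
  hypothesis, and by minimality \<open>C\<close> would span all loads of the violating set or family.  In the former
  case this set is rigid, so \<open>C\<close> lies in a single basis; in the latter case \<open>C\<close> resolves the loads of
  a subset of \<open>S\<close> although it avoids all but one vertex of \<open>S\<close>.  Both are absurd.  So the bases
  and the loads on \<open>S\<close> bound \<open>card F\<close> from below by the sum of the values of the maximal rigid
  sets, which is also the bound from above given by sparsity: all these values are attained.
\<close>

section \<open>Independent families of vectors\<close>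

instantiation "fun" :: (type, real_vector) real_vector
begin
definition "scaleR c f = (\<lambda>x. c *\<^sub>R f x)"
instance
  by standard (auto simp: scaleR_fun_def fun_eq_iff scaleR_add_right scaleR_add_left)
end

lemma scaleR_fun_apply [simp]: "(c *\<^sub>R f) x = c *\<^sub>R f x"
  by (simp add: scaleR_fun_def)

definition indep_family :: "'k set \<Rightarrow> ('k \<Rightarrow> 'b::real_vector) \<Rightarrow> bool" where
  "indep_family K g \<longleftrightarrow> (\<forall>a. (\<Sum>k\<in>K. a k *\<^sub>R g k) = 0 \<longrightarrow> (\<forall>k\<in>K. a k = 0))"

lemma indep_familyI:
  "(\<And>a k. (\<Sum>k\<in>K. a k *\<^sub>R g k) = 0 \<Longrightarrow> k \<in> K \<Longrightarrow> a k = 0) \<Longrightarrow> indep_family K g"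
  unfolding indep_family_def by blast

lemma indep_familyD:
  "indep_family K g \<Longrightarrow> (\<Sum>k\<in>K. a k *\<^sub>R g k) = 0 \<Longrightarrow> k \<in> K \<Longrightarrow> a k = 0"
  unfolding indep_family_def by blast

lemma indep_family_empty [simp]: "indep_family {} g"
  by (simp add: indep_family_def)

lemma indep_family_mono:
  assumes "finite K" "J \<subseteq> K" "indep_family K g"
  shows "indep_family J g"
proof (rule indep_familyI)
  fix a k assume a: "(\<Sum>k\<in>J. a k *\<^sub>R g k) = 0" and k: "k \<in> J"
  define b where "b k = (if k \<in> J then a k else 0)" for k
  have "(\<Sum>k\<in>K. b k *\<^sub>R g k) = (\<Sum>k\<in>J. b k *\<^sub>R g k)"
    using assms by (intro sum.mono_neutral_right) (auto simp: b_def)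
  also have "\<dots> = 0" using a by (simp add: b_def)
  finally have "b k = 0" using indep_familyD[OF assms(3)] k assms(2) by blast
  then show "a k = 0" using k by (simp add: b_def)
qed

lemma indep_family_imp_independent:
  assumes "finite K" "indep_family K g"
  shows "inj_on g K" and "independent (g ` K)"
proof -
  show inj: "inj_on g K"
  proof (rule inj_onI, rule ccontr)
    fix i j assume ij: "i \<in> K" "j \<in> K" "g i = g j" "i \<noteq> j"
    define a :: "'a \<Rightarrow> real" where "a k = (if k = i then 1 else if k = j then -1 else 0)" for k
    have "(\<Sum>k\<in>K. a k *\<^sub>R g k) = (\<Sum>k\<in>{i,j}. a k *\<^sub>R g k)"
      using assms ij by (intro sum.mono_neutral_right) (auto simp: a_def)
    also have "\<dots> = 0" using ij by (simp add: a_def)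
    finally have "a i = 0" using indep_familyD[OF assms(2)] ij(1) by blast
    then show False by (simp add: a_def)
  qed
  show "independent (g ` K)"
    unfolding dependent_finite[OF finite_imageI[OF assms(1)]]
  proof (clarsimp)
    fix u k assume u: "(\<Sum>v\<in>g ` K. u v *\<^sub>R v) = 0" and k: "k \<in> K" "u (g k) \<noteq> 0"
    have "(\<Sum>k\<in>K. u (g k) *\<^sub>R g k) = 0" using u by (simp add: sum.reindex[OF inj])
    then show False using indep_familyD[OF assms(2), of "\<lambda>k. u (g k)"] k by simp
  qed
qed

lemma indep_family_card_le:
  assumes "finite K" "indep_family K g" "finite G" "g ` K \<subseteq> span G"
  shows "card K \<le> card G"
  using independent_span_bound[OF assms(3) indep_family_imp_independent(2)[OF assms(1,2)] assms(4)]
    card_image[OF indep_family_imp_independent(1)[OF assms(1,2)]] by simp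

lemma indep_family_spans:
  assumes "finite K" "indep_family K g" "finite G" "g ` K \<subseteq> span G" "card G \<le> card K"
  shows "span G \<subseteq> span (g ` K)"
proof (rule subsetI, rule ccontr)
  fix f assume f: "f \<in> span G" "f \<notin> span (g ` K)"
  have "independent (insert f (g ` K))"
    using f indep_family_imp_independent[OF assms(1,2)] by (simp add: independent_insertI)
  from independent_span_bound[OF assms(3) this] f assms(4)
  have "card (insert f (g ` K)) \<le> card G" by auto
  moreover have "card (insert f (g ` K)) = Suc (card K)"
    using f assms(1) card_image[OF indep_family_imp_independent(1)[OF assms(1,2)]]
    by (subst card_insert_disjoint) (auto intro: span_base)
  ultimately show False using assms(5) by simp
qed

lemma indep_family_insert:
  assumes "finite K" "indep_family K g" "k \<notin> K" "g k \<notin> span (g ` K)"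
  shows "indep_family (insert k K) g"
proof (rule indep_familyI)
  fix a j assume a: "(\<Sum>j\<in>insert k K. a j *\<^sub>R g j) = 0" and j: "j \<in> insert k K"
  then have eq: "a k *\<^sub>R g k + (\<Sum>j\<in>K. a j *\<^sub>R g j) = 0" using assms by simp
  have ak: "a k = 0"
  proof (rule ccontr)
    assume "a k \<noteq> 0"
    then have "g k = (1 / a k) *\<^sub>R (a k *\<^sub>R g k)" by simp
    also have "\<dots> = (1 / a k) *\<^sub>R - (\<Sum>j\<in>K. a j *\<^sub>R g j)"
      using eq by (metis eq_neg_iff_add_eq_0)
    also have "\<dots> \<in> span (g ` K)" by (intro span_scale span_neg span_sum span_base) auto
    finally show False using assms by simp
  qed
  with eq have "(\<Sum>j\<in>K. a j *\<^sub>R g j) = 0" by simp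
  then show "a j = 0" using ak j indep_familyD[OF assms(2)] by blast
qed

lemma minimal_dependent_subfamily:
  assumes "finite K" "\<not> indep_family K g"
  obtains C where "C \<subseteq> K" "\<not> indep_family C g" "\<And>D. D \<subset> C \<Longrightarrow> indep_family D g"
proof -
  have "finite {C. C \<subseteq> K \<and> \<not> indep_family C g}" using assms by simp
  moreover have "{C. C \<subseteq> K \<and> \<not> indep_family C g} \<noteq> {}" using assms by auto
  ultimately obtain C where
    "C \<subseteq> K" "\<not> indep_family C g" "\<And>D. D \<subseteq> K \<Longrightarrow> \<not> indep_family D g \<Longrightarrow> D \<subseteq> C \<Longrightarrow> C = D"
    using finite_has_minimal[of "{C. C \<subseteq> K \<and> \<not> indep_family C g}"] by auto
  then show thesis using that by (metis order.trans psubset_eq)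
qed

section \<open>Polynomial functions at algebraically independent points\<close>

definition monomial_value :: "('i \<Rightarrow> real) \<Rightarrow> ('i \<Rightarrow>\<^sub>0 nat) \<Rightarrow> real" where
  "monomial_value x m = (\<Prod>i\<in>Poly_Mapping.keys m. x i ^ Poly_Mapping.lookup m i)"

lemma monomial_value_superset:
  assumes "finite A" "Poly_Mapping.keys m \<subseteq> A"
  shows "monomial_value x m = (\<Prod>i\<in>A. x i ^ Poly_Mapping.lookup m i)"
  unfolding monomial_value_def
  using assms by (intro prod.mono_neutral_left) (auto simp: in_keys_iff)

lemma monomial_value_add: "monomial_value x (m + n) = monomial_value x m * monomial_value x n"
proof -
  let ?A = "Poly_Mapping.keys m \<union> Poly_Mapping.keys n"
  have "monomial_value x (m + n) = (\<Prod>i\<in>?A. x i ^ Poly_Mapping.lookup (m + n) i)"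
    by (rule monomial_value_superset) (simp_all add: keys_add)
  also have "\<dots> = monomial_value x m * monomial_value x n"
    by (simp add: monomial_value_superset[of ?A] lookup_add power_add prod.distrib)
  finally show ?thesis .
qed

lemma eval_rat_mpoly_superset:
  assumes "finite A" "Poly_Mapping.keys q \<subseteq> A"
  shows "eval_rat_mpoly x q = (\<Sum>m\<in>A. of_rat (Poly_Mapping.lookup q m) * monomial_value x m)"
  unfolding eval_rat_mpoly_def monomial_value_def
  using assms by (intro sum.mono_neutral_left) (auto simp: in_keys_iff)

lemma eval_rat_mpoly_add: "eval_rat_mpoly x (q + r) = eval_rat_mpoly x q + eval_rat_mpoly x r"
proof -
  let ?A = "Poly_Mapping.keys q \<union> Poly_Mapping.keys r"
  have "eval_rat_mpoly x (q + r) =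
      (\<Sum>m\<in>?A. of_rat (Poly_Mapping.lookup (q + r) m) * monomial_value x m)"
    by (rule eval_rat_mpoly_superset) (simp_all add: keys_add)
  also have "\<dots> = eval_rat_mpoly x q + eval_rat_mpoly x r"
    by (simp add: eval_rat_mpoly_superset[of ?A] lookup_add of_rat_add algebra_simps sum.distrib)
  finally show ?thesis .
qed

lemma eval_rat_mpoly_0 [simp]: "eval_rat_mpoly x 0 = 0"
  by (simp add: eval_rat_mpoly_def)

lemma eval_rat_mpoly_sum: "eval_rat_mpoly x (sum q A) = (\<Sum>a\<in>A. eval_rat_mpoly x (q a))"
  by (induction A rule: infinite_finite_induct) (auto simp: eval_rat_mpoly_add)

lemma eval_rat_mpoly_single:
  "eval_rat_mpoly x (Poly_Mapping.single m c) = of_rat c * monomial_value x m"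
  by (subst eval_rat_mpoly_superset[of "{m}"]) auto

lemma poly_mapping_as_sum:
  fixes q :: "'k \<Rightarrow>\<^sub>0 'b::comm_monoid_add"
  shows "q = (\<Sum>m\<in>Poly_Mapping.keys q. Poly_Mapping.single m (Poly_Mapping.lookup q m))"
  by (rule poly_mapping_eqI)
    (auto simp: lookup_sum lookup_single when_def in_keys_iff sum.delta)

lemma eval_rat_mpoly_mult: "eval_rat_mpoly x (q * r) = eval_rat_mpoly x q * eval_rat_mpoly x r"
proof -
  let ?f = "\<lambda>q m. Poly_Mapping.single m (Poly_Mapping.lookup q m)"
  have "q * r = (\<Sum>m\<in>Poly_Mapping.keys q. ?f q m) * (\<Sum>n\<in>Poly_Mapping.keys r. ?f r n)"
    using poly_mapping_as_sum by metis
  also have "\<dots> = (\<Sum>m\<in>Poly_Mapping.keys q. \<Sum>n\<in>Poly_Mapping.keys r.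
      Poly_Mapping.single (m + n) (Poly_Mapping.lookup q m * Poly_Mapping.lookup r n))"
    by (simp add: sum_product mult_single)
  finally have "eval_rat_mpoly x (q * r) = (\<Sum>m\<in>Poly_Mapping.keys q. \<Sum>n\<in>Poly_Mapping.keys r.
      (of_rat (Poly_Mapping.lookup q m) * monomial_value x m) *
      (of_rat (Poly_Mapping.lookup r n) * monomial_value x n))"
    by (simp add: eval_rat_mpoly_sum eval_rat_mpoly_single monomial_value_add of_rat_mult ac_simps)
  also have "\<dots> = eval_rat_mpoly x q * eval_rat_mpoly x r"
    by (simp add: sum_product eval_rat_mpoly_def monomial_value_def)
  finally show ?thesis .
qed

text \<open>
  Polynomials as functions: these are closed under the ring operations by definition, which is all that
  elimination needs, and \<open>poly_functions_eval\<close> recovers the coefficients.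
\<close>

inductive_set poly_functions :: "'i set \<Rightarrow> (('i \<Rightarrow> real) \<Rightarrow> real) set" for I where
  const: "(\<lambda>x. of_rat c) \<in> poly_functions I"
| var: "i \<in> I \<Longrightarrow> (\<lambda>x. x i) \<in> poly_functions I"
| add: "f \<in> poly_functions I \<Longrightarrow> g \<in> poly_functions I \<Longrightarrow> (\<lambda>x. f x + g x) \<in> poly_functions I"
| mult: "f \<in> poly_functions I \<Longrightarrow> g \<in> poly_functions I \<Longrightarrow> (\<lambda>x. f x * g x) \<in> poly_functions I"

lemma poly_functions_diff:
  assumes "f \<in> poly_functions I" "g \<in> poly_functions I"
  shows "(\<lambda>x. f x - g x) \<in> poly_functions I"
  using poly_functions.add[OF assms(1) poly_functions.mult[OF poly_functions.const[of "-1"] assms(2)]]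
  by (simp add: of_rat_minus)

lemma poly_functions_eval:
  assumes "f \<in> poly_functions I"
  shows "\<exists>q. (\<forall>m\<in>Poly_Mapping.keys q. Poly_Mapping.keys m \<subseteq> I) \<and> f = (\<lambda>x. eval_rat_mpoly x q)"
  using assms
proof induction
  case (const c)
  show ?case
    by (rule exI[of _ "Poly_Mapping.single 0 c"])
      (auto simp: eval_rat_mpoly_single monomial_value_def split: if_splits)
next
  case (var i)
  then show ?case
    by (intro exI[of _ "Poly_Mapping.single (Poly_Mapping.single i 1) 1"])
      (auto simp: eval_rat_mpoly_single monomial_value_def)
next
  case (add f g)
  then obtain q r where "\<forall>m\<in>Poly_Mapping.keys q. Poly_Mapping.keys m \<subseteq> I" "f = (\<lambda>x. eval_rat_mpoly x q)"
    "\<forall>m\<in>Poly_Mapping.keys r. Poly_Mapping.keys m \<subseteq> I" "g = (\<lambda>x. eval_rat_mpoly x r)"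
    by auto
  then show ?case
    by (intro exI[of _ "q + r"]) (use keys_add in \<open>fastforce simp: eval_rat_mpoly_add\<close>)
next
  case (mult f g)
  then obtain q r where qr: "\<forall>m\<in>Poly_Mapping.keys q. Poly_Mapping.keys m \<subseteq> I" "f = (\<lambda>x. eval_rat_mpoly x q)"
    "\<forall>m\<in>Poly_Mapping.keys r. Poly_Mapping.keys m \<subseteq> I" "g = (\<lambda>x. eval_rat_mpoly x r)"
    by auto
  have "Poly_Mapping.keys m \<subseteq> I" if "m \<in> Poly_Mapping.keys (q * r)" for m
  proof -
    from that keys_mult[of q r] obtain a b where
      "a \<in> Poly_Mapping.keys q" "b \<in> Poly_Mapping.keys r" "m = a + b" by blast
    then show ?thesis using qr keys_add[of a b] by blast
  qed
  then show ?case using qr by (intro exI[of _ "q * r"]) (auto simp: eval_rat_mpoly_mult)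
qed

lemma poly_function_nonzero_at_generic_point:
  assumes "alg_indep_over_rat I x" "f \<in> poly_functions I" "f y \<noteq> 0"
  shows "f x \<noteq> 0"
proof
  assume 0: "f x = 0"
  obtain q where q: "\<forall>m\<in>Poly_Mapping.keys q. Poly_Mapping.keys m \<subseteq> I" "f = (\<lambda>x. eval_rat_mpoly x q)"
    using poly_functions_eval[OF assms(2)] by blast
  with 0 assms(1) have "q = 0" unfolding alg_indep_over_rat_def by auto
  with q assms(3) show False by simp
qed

text \<open>
  Fraction-free elimination keeps the entries polynomial; pivots that do not vanish at \<open>y\<close>
  do not vanish at the generic point \<open>x\<close> either.
\<close>

lemma rows_independent_at_generic_point:
  assumes x: "alg_indep_over_rat I x"
    and "finite R" "\<And>r c. r \<in> R \<Longrightarrow> c \<in> C \<Longrightarrow> M r c \<in> poly_functions I"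
    and "rows_independent R C (\<lambda>r c. M r c y)"
  shows "rows_independent R C (\<lambda>r c. M r c x)"
  using assms(2-)
proof (induction R arbitrary: M rule: finite_induct)
  case empty
  then show ?case by (simp add: rows_independent_def)
next
  case (insert s R)
  have "\<exists>c\<in>C. M s c y \<noteq> 0"
  proof (rule ccontr)
    assume "\<not> ?thesis"
    then have "\<forall>c\<in>C. (\<Sum>r\<in>insert s R. (if r = s then 1 else 0) * M r c y) = 0"
      using insert.hyps by (auto intro!: sum.neutral)
    then have "\<forall>r\<in>insert s R. (if r = s then 1 else 0::real) = 0"
      using insert.prems(2)[unfolded rows_independent_def, THEN spec, of "\<lambda>r. if r = s then 1 else 0"]
      by simp
    then show False by simp
  qed
  then obtain k where k: "k \<in> C" "M s k y \<noteq> 0" by blast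
  then have kx: "M s k x \<noteq> 0"
    using poly_function_nonzero_at_generic_point[OF x] insert.prems(1) by blast
  \<comment> \<open>The rows after elimination of column \<open>k\<close>, multiplied by the pivot to avoid division.\<close>
  define N where "N r c = (\<lambda>z. M s k z * M r c z - M r k z * M s c z)" for r c
  have "rows_independent R C (\<lambda>r c. N r c y)"
    unfolding rows_independent_def
  proof (intro allI impI ballI)
    fix a r assume a: "\<forall>c\<in>C. (\<Sum>r\<in>R. a r * N r c y) = 0" and r: "r \<in> R"
    define b where "b r = (if r = s then - (\<Sum>r\<in>R. a r * M r k y) else a r * M s k y)" for r
    have "(\<Sum>r\<in>insert s R. b r * M r c y) = 0" if "c \<in> C" for c
    proof -
      have "(\<Sum>r\<in>insert s R. b r * M r c y) =
          - (\<Sum>r\<in>R. a r * M r k y) * M s c y + (\<Sum>r\<in>R. a r * M s k y * M r c y)"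
        using insert.hyps by (auto simp: b_def intro!: sum.cong)
      also have "\<dots> = (\<Sum>r\<in>R. a r * N r c y)"
        by (simp add: N_def sum_distrib_left sum_subtractf algebra_simps)
      finally show ?thesis using a that by simp
    qed
    then have "b r = 0" using insert.prems(2) r unfolding rows_independent_def by blast
    then show "a r = 0" using r insert.hyps k by (auto simp: b_def split: if_splits)
  qed
  moreover have "N r c \<in> poly_functions I" if "r \<in> R" "c \<in> C" for r c
    unfolding N_def using insert.prems(1) that k
    by (intro poly_functions_diff poly_functions.mult) auto
  ultimately have ind: "rows_independent R C (\<lambda>r c. N r c x)"
    using insert.IH[of N] by blast
  show ?case
    unfolding rows_independent_def
  proof (intro allI impI ballI)
    fix a r assume a: "\<forall>c\<in>C. (\<Sum>r\<in>insert s R. a r * M r c x) = 0" and r: "r \<in> insert s R"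
    have eq: "a s * M s c x = - (\<Sum>r\<in>R. a r * M r c x)" if "c \<in> C" for c
    proof -
      have "a s * M s c x + (\<Sum>r\<in>R. a r * M r c x) = 0" using a that insert.hyps by simp
      then show ?thesis by linarith
    qed
    have "(\<Sum>r\<in>R. a r * N r c x) = 0" if "c \<in> C" for c
    proof -
      have "(\<Sum>r\<in>R. a r * N r c x) =
          M s k x * (\<Sum>r\<in>R. a r * M r c x) - (\<Sum>r\<in>R. a r * M r k x) * M s c x"
        by (simp add: N_def sum_distrib_right sum_distrib_left sum_subtractf algebra_simps)
      also have "\<dots> = M s k x * - (a s * M s c x) + (a s * M s k x) * M s c x"
        using eq[OF that] eq[OF k(1)] by simp
      finally show ?thesis by simp
    qed
    then have 0: "\<forall>r\<in>R. a r = 0" using ind unfolding rows_independent_def by blast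
    then have "a s * M s k x = 0" using eq[OF k(1)] by simp
    with 0 kx r show "a r = 0" by auto
  qed
qed

section \<open>Equilibrium loads\<close>

lemma sum_apply: "(\<Sum>k\<in>K. g k) v = (\<Sum>k\<in>K. g k v)" for g :: "'k \<Rightarrow> 'v \<Rightarrow> 'b::comm_monoid_add"
  by (induction K rule: infinite_finite_induct) auto

definition cross2 :: "real ^ 2 \<Rightarrow> real ^ 2 \<Rightarrow> real" where
  "cross2 a b = a $ 1 * b $ 2 - a $ 2 * b $ 1"

lemma cross2_linear:
  "cross2 a (b + c) = cross2 a b + cross2 a c" "cross2 a (b - c) = cross2 a b - cross2 a c"
  "cross2 a (r *\<^sub>R b) = r * cross2 a b" "cross2 a 0 = 0" "cross2 a (- b) = - cross2 a b"
  "cross2 (a - b) c = cross2 a c - cross2 b c" "cross2 0 a = 0" "cross2 a a = 0"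
  by (auto simp: cross2_def algebra_simps)

lemma vec2_eq_iff: "a = b \<longleftrightarrow> a $ 1 = b $ 1 \<and> a $ 2 = b $ 2" for a b :: "real ^ 2"
  by (simp add: vec_eq_iff forall_2)

lemma cross2_eq_0_imp_parallel:
  assumes "cross2 a b = 0" "a \<noteq> 0"
  obtains c where "b = c *\<^sub>R a"
proof (cases "a $ 1 = 0")
  case True
  then have "a $ 2 \<noteq> 0" using assms by (auto simp: vec2_eq_iff)
  then have "b = (b $ 2 / a $ 2) *\<^sub>R a"
    using assms True by (auto simp: vec2_eq_iff cross2_def)
  then show ?thesis by (rule that)
next
  case False
  then have "b = (b $ 1 / a $ 1) *\<^sub>R a"
    using assms by (auto simp: vec2_eq_iff cross2_def field_simps)
  then show ?thesis by (rule that)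
qed

text \<open>Rows of the rigidity matrix, read as one force at each vertex.\<close>

definition edge_load :: "('v \<Rightarrow> real ^ 2) \<Rightarrow> 'v set \<Rightarrow> 'v \<Rightarrow> real ^ 2" where
  "edge_load p e v = (\<chi> i. rigidity_matrix p e (v, i))"

definition point_load :: "'v \<Rightarrow> real ^ 2 \<Rightarrow> 'v \<Rightarrow> real ^ 2" where
  "point_load x w v = (if v = x then w else 0)"

lemma edge_load_outside: "v \<notin> e \<Longrightarrow> edge_load p e v = 0"
  by (simp add: edge_load_def rigidity_matrix_def vec_eq_iff)

lemma edge_load_endpoint: "u \<noteq> w \<Longrightarrow> edge_load p {u, w} u = p u - p w"
proof -
  assume "u \<noteq> w"
  then have "(THE x. {u, w} = {u, x}) = w" by (intro the_equality) (auto simp: doubleton_eq_iff)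
  then show ?thesis by (simp add: edge_load_def rigidity_matrix_def vec_eq_iff)
qed

lemma edge_load_other_endpoint: "u \<noteq> w \<Longrightarrow> edge_load p {u, w} w = p w - p u"
  using edge_load_endpoint[of w u p] by (simp add: insert_commute)

lemma edge_load_conv_point_load:
  "u \<noteq> w \<Longrightarrow> edge_load p {u, w} = point_load u (p u - p w) + point_load w (p w - p u)"
  by (auto simp: fun_eq_iff point_load_def edge_load_endpoint edge_load_other_endpoint edge_load_outside)

lemma edge_load_cong: "(\<And>v. v \<in> e \<Longrightarrow> p v = q v) \<Longrightarrow> card e = 2 \<Longrightarrow> edge_load p e = edge_load q e"
  by (auto simp: card_2_iff edge_load_conv_point_load)

lemma rows_independent_iff_indep_family:
  assumes "\<And>e. e \<in> F \<Longrightarrow> e \<subseteq> V"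
  shows "rows_independent F (V \<times> UNIV) (rigidity_matrix p) \<longleftrightarrow> indep_family F (edge_load p)"
proof -
  have "(\<Sum>e\<in>F. a e *\<^sub>R edge_load p e) = 0 \<longleftrightarrow>
      (\<forall>c\<in>V \<times> UNIV. (\<Sum>e\<in>F. a e * rigidity_matrix p e c) = 0)" for a
  proof -
    have "(\<Sum>e\<in>F. a e *\<^sub>R edge_load p e) = 0 \<longleftrightarrow> (\<forall>v i. (\<Sum>e\<in>F. a e * rigidity_matrix p e (v, i)) = 0)"
      by (simp add: fun_eq_iff sum_apply vec_eq_iff sum_component edge_load_def)
    also have "\<dots> \<longleftrightarrow> (\<forall>v\<in>V. \<forall>i. (\<Sum>e\<in>F. a e * rigidity_matrix p e (v, i)) = 0)"
    proof -
      have "rigidity_matrix p e (v, i) = 0" if "v \<notin> V" "e \<in> F" for e v i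
        using assms that by (auto simp: rigidity_matrix_def)
      then have "(\<Sum>e\<in>F. a e * rigidity_matrix p e (v, i)) = 0" if "v \<notin> V" for v i
        using that by (intro sum.neutral) auto
      then show ?thesis by blast
    qed
    finally show ?thesis by auto
  qed
  then show ?thesis unfolding rows_independent_def indep_family_def by simp
qed

text \<open>
  The first sum is the resultant of the forces, the second one their moment about the origin.
\<close>

definition eq_loads :: "('v \<Rightarrow> real ^ 2) \<Rightarrow> 'v set \<Rightarrow> ('v \<Rightarrow> real ^ 2) set" where
  "eq_loads p X = {f. (\<forall>v. v \<notin> X \<longrightarrow> f v = 0) \<and> (\<Sum>v\<in>X. f v) = 0 \<and> (\<Sum>v\<in>X. cross2 (p v) (f v)) = 0}"

lemma eq_loads_mono:
  assumes "finite Y" "X \<subseteq> Y"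
  shows "eq_loads p X \<subseteq> eq_loads p Y"
proof
  fix f assume f: "f \<in> eq_loads p X"
  have "(\<Sum>v\<in>Y. f v) = (\<Sum>v\<in>X. f v)"
    using f assms by (intro sum.mono_neutral_right) (auto simp: eq_loads_def)
  moreover have "(\<Sum>v\<in>Y. cross2 (p v) (f v)) = (\<Sum>v\<in>X. cross2 (p v) (f v))"
    using f assms by (intro sum.mono_neutral_right) (auto simp: eq_loads_def cross2_linear)
  ultimately show "f \<in> eq_loads p Y" using f assms by (auto simp: eq_loads_def)
qed

lemma eq_loads_restrict:
  assumes "finite Y" "X \<subseteq> Y" "f \<in> eq_loads p Y" "\<And>v. v \<notin> X \<Longrightarrow> f v = 0"
  shows "f \<in> eq_loads p X"
proof -
  have "(\<Sum>v\<in>Y. f v) = (\<Sum>v\<in>X. f v)"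
    using assms by (intro sum.mono_neutral_right) auto
  moreover have "(\<Sum>v\<in>Y. cross2 (p v) (f v)) = (\<Sum>v\<in>X. cross2 (p v) (f v))"
    using assms by (intro sum.mono_neutral_right) (auto simp: cross2_linear)
  ultimately show ?thesis using assms by (auto simp: eq_loads_def)
qed

lemma subspace_eq_loads: "subspace (eq_loads p X)"
  by (auto simp: subspace_def eq_loads_def cross2_linear sum.distrib
      simp flip: scaleR_sum_right sum_distrib_left)

lemma point_load_sum:
  assumes "finite X" "x \<in> X"
  shows "(\<Sum>v\<in>X. point_load x w v) = w" "(\<Sum>v\<in>X. cross2 (p v) (point_load x w v)) = cross2 (p x) w"
proof -
  show "(\<Sum>v\<in>X. point_load x w v) = w"
    using assms by (simp add: point_load_def sum.delta)
  have "(\<Sum>v\<in>X. cross2 (p v) (point_load x w v)) = (\<Sum>v\<in>X. if v = x then cross2 (p x) w else 0)"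
    by (intro sum.cong) (auto simp: point_load_def cross2_linear)
  then show "(\<Sum>v\<in>X. cross2 (p v) (point_load x w v)) = cross2 (p x) w"
    using assms by (simp add: sum.delta)
qed

lemma eq_loadsI:
  "(\<And>v. v \<notin> X \<Longrightarrow> f v = 0) \<Longrightarrow> (\<Sum>v\<in>X. f v) = 0 \<Longrightarrow> (\<Sum>v\<in>X. cross2 (p v) (f v)) = 0 \<Longrightarrow> f \<in> eq_loads p X"
  by (simp add: eq_loads_def)

lemma eq_loadsD:
  assumes "f \<in> eq_loads p X"
  shows "v \<notin> X \<Longrightarrow> f v = 0" "(\<Sum>v\<in>X. f v) = 0" "(\<Sum>v\<in>X. cross2 (p v) (f v)) = 0"
  using assms by (simp_all add: eq_loads_def)

lemma edge_load_in_eq_loads: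
  assumes "finite X" "e \<subseteq> X" "card e = 2"
  shows "edge_load p e \<in> eq_loads p X"
proof -
  obtain u w where e: "e = {u, w}" "u \<noteq> w" using assms(3) by (auto simp: card_2_iff)
  then have uw: "u \<in> X" "w \<in> X" using assms(2) by auto
  have "cross2 (p u) (p u - p w) + cross2 (p w) (p w - p u) = 0"
    by (simp add: cross2_def algebra_simps)
  then show ?thesis
    unfolding e(1) edge_load_conv_point_load[OF e(2)]
    by (intro eq_loadsI)
      (use uw in \<open>simp_all add: sum.distrib cross2_linear(1) point_load_sum[OF assms(1)] del: cross2_linear(2),
       auto simp: point_load_def\<close>)
qed

text \<open>
  The force \<open>w\<close> at \<open>x\<close>, held in equilibrium by forces at two distinct points: the one at \<open>b\<close> is
  perpendicular to the bar \<open>ab\<close> and cancels the moment about \<open>a\<close>.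
\<close>

definition lever_force :: "real ^ 2 \<Rightarrow> real ^ 2 \<Rightarrow> real ^ 2 \<Rightarrow> real ^ 2 \<Rightarrow> real ^ 2" where
  "lever_force a b x w = (- cross2 (x - a) w / ((b - a) \<bullet> (b - a))) *\<^sub>R vector [- (b - a) $ 2, (b - a) $ 1]"

definition lever :: "('v \<Rightarrow> real ^ 2) \<Rightarrow> 'v \<Rightarrow> 'v \<Rightarrow> 'v \<Rightarrow> real ^ 2 \<Rightarrow> 'v \<Rightarrow> real ^ 2" where
  "lever p a b x w = (let r = lever_force (p a) (p b) (p x) w
     in point_load x w + point_load b r + point_load a (- w - r))"

lemma cross2_lever_force:
  assumes "a \<noteq> b"
  shows "cross2 (b - a) (lever_force a b x w) = - cross2 (x - a) w"
proof -
  have "(b - a) \<bullet> (b - a) \<noteq> 0" using assms by simp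
  moreover have "cross2 (b - a) (vector [- (b - a) $ 2, (b - a) $ 1]) = (b - a) \<bullet> (b - a)"
    by (simp add: cross2_def inner_vec_def sum_2 algebra_simps)
  ultimately show ?thesis by (simp add: lever_force_def cross2_linear(3,5))
qed

lemma lever_in_eq_loads:
  assumes "finite X" "a \<in> X" "b \<in> X" "x \<in> X" "p a \<noteq> p b"
  shows "lever p a b x w \<in> eq_loads p X"
proof -
  let ?r = "lever_force (p a) (p b) (p x) w"
  have "cross2 (p b - p a) ?r = - cross2 (p x - p a) w" using cross2_lever_force assms by blast
  then have "cross2 (p x) w + cross2 (p b) ?r + cross2 (p a) (- w - ?r) = 0"
    by (simp add: cross2_linear)
  then show ?thesis using assms
    by (auto simp: eq_loads_def lever_def Let_def sum.distrib cross2_linear point_load_sum)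
      (auto simp: point_load_def)
qed

lemma lever_apply: "v \<noteq> a \<Longrightarrow> v \<noteq> b \<Longrightarrow> lever p a b x w v = (if v = x then w else 0)"
  by (simp add: lever_def Let_def point_load_def)

lemma lever_linear: "lever p a b x w = w $ 1 *\<^sub>R lever p a b x (axis 1 1) + w $ 2 *\<^sub>R lever p a b x (axis 2 1)"
proof -
  have "w = w $ 1 *\<^sub>R axis 1 1 + w $ 2 *\<^sub>R axis 2 1" by (simp add: vec2_eq_iff axis_def)
  then have "cross2 c w = w $ 1 * cross2 c (axis 1 1) + w $ 2 * cross2 c (axis 2 1)" for c
    by (metis cross2_linear(1,3))
  then have "lever_force a b x w = w $ 1 *\<^sub>R lever_force a b x (axis 1 1) + w $ 2 *\<^sub>R lever_force a b x (axis 2 1)"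
    for a b x
  proof -
    assume *: "\<And>c. cross2 c w = w $ 1 * cross2 c (axis 1 1) + w $ 2 * cross2 c (axis 2 1)"
    have "(- cross2 c w / d) *\<^sub>R e = w $ 1 *\<^sub>R ((- cross2 c (axis 1 1) / d) *\<^sub>R e) +
        w $ 2 *\<^sub>R ((- cross2 c (axis 2 1) / d) *\<^sub>R e)" for c d and e :: "real ^ 2"
      by (simp add: *[of c] vec2_eq_iff add_divide_distrib diff_divide_distrib ring_distribs)
    then show ?thesis by (simp only: lever_force_def)
  qed
  then show ?thesis
    by (simp add: fun_eq_iff lever_def Let_def point_load_def vec2_eq_iff axis_def algebra_simps)
qed

lemma eq_loads_pair:
  assumes "f \<in> eq_loads p {a, b}" "p a \<noteq> p b"
  obtains c where "f = c *\<^sub>R edge_load p {a, b}"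
proof -
  have ab: "a \<noteq> b" using assms by auto
  have f: "f a + f b = 0" "cross2 (p a) (f a) + cross2 (p b) (f b) = 0" "\<And>v. v \<noteq> a \<Longrightarrow> v \<noteq> b \<Longrightarrow> f v = 0"
    using eq_loadsD[OF assms(1)] ab by simp_all
  then have fb: "f b = - f a" by (metis eq_neg_iff_add_eq_0 add.commute)
  with f(2) have "cross2 (p a - p b) (f a) = 0" by (simp add: cross2_linear)
  then obtain c where c: "f a = c *\<^sub>R (p a - p b)"
    using cross2_eq_0_imp_parallel assms by (metis right_minus_eq)
  have "f = c *\<^sub>R edge_load p {a, b}"
  proof
    fix v show "f v = (c *\<^sub>R edge_load p {a, b}) v"
      using f(3) c fb ab
      by (cases "v = a"; cases "v = b")
        (auto simp: edge_load_endpoint edge_load_other_endpoint edge_load_outside algebra_simps)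
  qed
  then show ?thesis by (rule that)
qed

text \<open>
  Levers move all forces to two vertices, and equal opposite forces there act along the bar.
\<close>

lemma eq_loads_decompose:
  assumes "finite X" "a \<in> X" "b \<in> X" "p a \<noteq> p b" "f \<in> eq_loads p X"
  obtains c where "f = c *\<^sub>R edge_load p {a, b} + (\<Sum>x\<in>X - {a, b}. lever p a b x (f x))"
proof -
  define g where "g = f - (\<Sum>x\<in>X - {a, b}. lever p a b x (f x))"
  have "g \<in> eq_loads p X"
    unfolding g_def using assms
    by (intro subspace_diff[OF subspace_eq_loads] subspace_sum[OF subspace_eq_loads] lever_in_eq_loads) auto
  moreover have "g v = 0" if "v \<notin> {a, b}" for v
  proof -
    have "(\<Sum>x\<in>X - {a, b}. lever p a b x (f x)) v = (\<Sum>x\<in>X - {a, b}. if x = v then f v else 0)"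
      unfolding sum_apply using that by (intro sum.cong) (auto simp: lever_apply)
    also have "\<dots> = f v" using that assms by (auto simp: sum.delta eq_loads_def)
    finally show ?thesis by (simp add: g_def)
  qed
  ultimately have "g \<in> eq_loads p {a, b}"
    using eq_loads_restrict[of X "{a, b}" g p] assms(1-3) by simp
  then obtain c where "g = c *\<^sub>R edge_load p {a, b}" using eq_loads_pair assms by metis
  then show ?thesis by (intro that[of c]) (simp add: g_def algebra_simps)
qed

lemma eq_loads_subset_if_levers:
  assumes "finite X" "a \<in> X" "b \<in> X" "p a \<noteq> p b" "subspace L" "edge_load p {a, b} \<in> L"
    and "\<And>x w. x \<in> X - {a, b} \<Longrightarrow> lever p a b x w \<in> L"
  shows "eq_loads p X \<subseteq> L"
proof
  fix f assume "f \<in> eq_loads p X"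
  then obtain c where c: "f = c *\<^sub>R edge_load p {a, b} + (\<Sum>x\<in>X - {a, b}. lever p a b x (f x))"
    using eq_loads_decompose assms(1-4) by metis
  have "c *\<^sub>R edge_load p {a, b} \<in> L" using assms(5,6) by (rule subspace_scale)
  moreover have "(\<Sum>x\<in>X - {a, b}. lever p a b x (f x)) \<in> L"
    using assms(5,7) by (rule subspace_sum)
  ultimately show "f \<in> L" using c subspace_add[OF assms(5)] by metis
qed

text \<open>
  With levers supported at the common points \<open>a\<close> and \<open>b\<close>, every force at a vertex of \<open>X \<union> Y\<close> is moved
  there inside \<open>X\<close> or inside \<open>Y\<close>.
\<close>

lemma eq_loads_union_two_points:
  assumes "finite X" "finite Y" "a \<in> X \<inter> Y" "b \<in> X \<inter> Y" "p a \<noteq> p b" "subspace L"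
    and "eq_loads p X \<subseteq> L" "eq_loads p Y \<subseteq> L"
  shows "eq_loads p (X \<union> Y) \<subseteq> L"
proof (rule eq_loads_subset_if_levers[of _ a b])
  have "edge_load p {a, b} \<in> eq_loads p X"
    using assms by (intro edge_load_in_eq_loads) (auto simp: card_2_iff)
  then show "edge_load p {a, b} \<in> L" using assms by auto
next
  fix x w assume x: "x \<in> X \<union> Y - {a, b}"
  have "lever p a b x w \<in> eq_loads p X \<union> eq_loads p Y"
    using assms x by (auto intro: lever_in_eq_loads)
  then show "lever p a b x w \<in> L" using assms by auto
qed (use assms in auto)

lemma eq_loads_spanning_set:
  assumes "finite X" "a \<in> X" "b \<in> X" "p a \<noteq> p b"
  obtains G where "finite G" "card G + 3 \<le> 2 * card X" "eq_loads p X \<subseteq> span G"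
proof
  let ?D = "(\<lambda>(x, i). lever p a b x (axis i 1)) ` ((X - {a, b}) \<times> (UNIV :: 2 set))"
  let ?G = "insert (edge_load p {a, b}) ?D"
  show "finite ?G" using assms by auto
  have ab: "a \<noteq> b" using assms by auto
  have "card ?D \<le> card ((X - {a, b}) \<times> (UNIV :: 2 set))" using assms by (intro card_image_le) auto
  also have "\<dots> = 2 * (card X - 2)"
    using assms ab by (simp add: card_cartesian_product card_Diff_subset)
  finally have "card ?G \<le> Suc (2 * (card X - 2))"
    using assms by (intro order.trans[OF card_insert_le_m1]) auto
  moreover have "card X \<ge> 2" using assms ab card_mono[of X "{a, b}"] by simp
  ultimately show "card ?G + 3 \<le> 2 * card X" by linarith
  show "eq_loads p X \<subseteq> span ?G"
  proof (rule eq_loads_subset_if_levers[of _ a b])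
    fix x w assume x: "x \<in> X - {a, b}"
    have "lever p a b x (axis i 1) \<in> span ?G" for i
      by (rule span_base) (use x in force)
    then show "lever p a b x w \<in> span ?G"
      by (subst lever_linear) (intro span_add span_scale)
  qed (use assms in \<open>auto intro: span_base\<close>)
qed

text \<open>On coincident vertices a load is in equilibrium as soon as the forces add up to zero.\<close>

lemma transfer_load_coincident:
  assumes "finite S" "s \<in> S" "x \<in> S" "p x = p s"
  shows "point_load x w - point_load s w \<in> eq_loads p S"
  using assms
  by (auto simp: eq_loads_def sum_subtractf cross2_linear point_load_sum) (auto simp: point_load_def)

text \<open>
  The force at a vertex of \<open>S\<close> outside \<open>X\<close> is moved to the common vertex \<open>s\<close>, without any moment.
\<close>

lemma eq_loads_union_coincident:
  assumes "finite X" "finite S" "s \<in> X" "s \<in> S" "coincident_realisation S s p" "subspace L"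
    and "eq_loads p X \<subseteq> L" "eq_loads p S \<subseteq> L"
  shows "eq_loads p (X \<union> S) \<subseteq> L"
proof
  fix f assume f: "f \<in> eq_loads p (X \<union> S)"
  define h where "h = (\<Sum>x\<in>S - X. point_load x (f x) - point_load s (f x))"
  have h: "h \<in> eq_loads p S"
    unfolding h_def using assms(2,4)
    by (intro subspace_sum[OF subspace_eq_loads] transfer_load_coincident
        assms(5)[unfolded coincident_realisation_def, rule_format]) auto
  have "f - h \<in> eq_loads p X"
  proof (rule eq_loads_restrict[of "X \<union> S"])
    show "f - h \<in> eq_loads p (X \<union> S)"
      using h f assms eq_loads_mono[of "X \<union> S" S p]
      by (intro subspace_diff[OF subspace_eq_loads]) auto
    fix v assume v: "v \<notin> X"
    then have "h v = (\<Sum>x\<in>S - X. if x = v then f v else 0)"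
      unfolding h_def sum_apply using assms by (intro sum.cong) (auto simp: point_load_def)
    then show "(f - h) v = 0" using v assms(1,2) eq_loadsD(1)[OF f, of v] by (auto simp: sum.delta)
  qed (use assms in auto)
  then have "f - h + h \<in> L" using h assms by (intro subspace_add) auto
  then show "f \<in> L" by simp
qed

lemma eq_loads_coincident_spanning_set:
  assumes "finite S" "s \<in> S" "coincident_realisation S s p"
  obtains G where "finite G" "card G + 2 \<le> 2 * card S" "eq_loads p S \<subseteq> span G"
proof
  let ?g = "\<lambda>(x, i). point_load x (axis i 1) - point_load s (axis i 1)"
  let ?G = "?g ` ((S - {s}) \<times> (UNIV :: 2 set))"
  show "finite ?G" using assms by auto
  have "card ?G \<le> card ((S - {s}) \<times> (UNIV :: 2 set))" using assms by (intro card_image_le) auto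
  moreover have "card S \<ge> 1" using assms card_gt_0_iff[of S] by auto
  ultimately show "card ?G + 2 \<le> 2 * card S"
    using assms by (simp add: card_cartesian_product)
  show "eq_loads p S \<subseteq> span ?G"
  proof
    fix f assume f: "f \<in> eq_loads p S"
    have "point_load x (axis i 1) - point_load s (axis i 1) \<in> span ?G" if "x \<in> S - {s}" for x i
      by (rule span_base) (use that in force)
    moreover have "point_load x w - point_load s w =
        w $ 1 *\<^sub>R (point_load x (axis 1 1) - point_load s (axis 1 1)) +
        w $ 2 *\<^sub>R (point_load x (axis 2 1) - point_load s (axis 2 1))" for x w
      by (auto simp: fun_eq_iff point_load_def vec2_eq_iff axis_def)
    ultimately have mem: "point_load x w - point_load s w \<in> span ?G" if "x \<in> S - {s}" for x w
      using that by (metis (no_types, lifting) span_add span_scale)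
    have "f = (\<Sum>x\<in>S - {s}. point_load x (f x) - point_load s (f x))"
    proof
      fix v
      show "f v = (\<Sum>x\<in>S - {s}. point_load x (f x) - point_load s (f x)) v"
      proof (cases "v = s")
        case True
        have "(\<Sum>x\<in>S. f x) = 0" using f by (simp add: eq_loads_def)
        then have "f s = - (\<Sum>x\<in>S - {s}. f x)"
          using assms by (simp add: sum.remove[of S s] add_eq_0_iff2)
        also have "\<dots> = (\<Sum>x\<in>S - {s}. - f x)" by (simp add: sum_negf)
        also have "\<dots> = (\<Sum>x\<in>S - {s}. (point_load x (f x) - point_load s (f x)) v)"
          using True by (intro sum.cong) (auto simp: point_load_def)
        finally show ?thesis using True by (simp add: sum_apply)
      next
        case False
        have "(\<Sum>x\<in>S - {s}. (point_load x (f x) - point_load s (f x)) v) = (\<Sum>x\<in>S - {s}. if x = v then f v else 0)"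
          using False by (intro sum.cong) (auto simp: point_load_def)
        then show ?thesis
          using False assms(1) eq_loadsD(1)[OF f, of v] by (auto simp: sum_apply sum.delta)
      qed
    qed
    also have "\<dots> \<in> span ?G" by (intro span_sum mem)
    finally show "f \<in> span ?G" .
  qed
qed

section \<open>Independent edge sets are sparse\<close>

lemma indep_family_nonzero:
  assumes "finite K" "indep_family K g" "k \<in> K"
  shows "g k \<noteq> 0"
proof
  assume "g k = 0"
  then have "(\<Sum>j\<in>K. (if j = k then 1 else 0) *\<^sub>R g j) = 0"
    by (intro sum.neutral) auto
  from indep_familyD[OF assms(2) this assms(3)] show False by simp
qed

lemma edge_load_nonzero_imp_distinct:
  assumes "card e = 2" "edge_load p e \<noteq> 0"
  obtains a b where "e = {a, b}" "p a \<noteq> p b"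
proof -
  obtain a b where e: "e = {a, b}" "a \<noteq> b" using assms(1) by (auto simp: card_2_iff)
  have "p a \<noteq> p b"
  proof
    assume "p a = p b"
    then have "edge_load p e = 0" using e by (auto simp: edge_load_conv_point_load point_load_def fun_eq_iff)
    with assms show False by simp
  qed
  with e show ?thesis using that by blast
qed

lemma indep_imp_induced_edges_le:
  assumes "finite F" "\<And>e. e \<in> F \<Longrightarrow> card e = 2" "indep_family F (edge_load p)"
    and "finite X" "2 \<le> card X"
  shows "int (induced_edges F X) \<le> 2 * int (card X) - 3"
proof (cases "{e \<in> F. e \<subseteq> X} = {}")
  case True
  then show ?thesis using assms by (simp only: induced_edges_def) simp
next
  case False
  then obtain e where e: "e \<in> F" "e \<subseteq> X" by blast
  obtain a b where ab: "e = {a, b}" "p a \<noteq> p b"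
    using edge_load_nonzero_imp_distinct assms(2) indep_family_nonzero[OF assms(1,3)] e by metis
  obtain G where G: "finite G" "card G + 3 \<le> 2 * card X" "eq_loads p X \<subseteq> span G"
    using eq_loads_spanning_set[of X a b p] assms ab e by auto
  have "card {e \<in> F. e \<subseteq> X} \<le> card G"
  proof (rule indep_family_card_le[OF _ _ G(1)])
    show "indep_family {e \<in> F. e \<subseteq> X} (edge_load p)"
      by (rule indep_family_mono[OF assms(1) _ assms(3)]) auto
    show "edge_load p ` {e \<in> F. e \<subseteq> X} \<subseteq> span G"
      using subsetD[OF G(3) edge_load_in_eq_loads[OF assms(4) _ assms(2)]] by auto
  qed (use assms in auto)
  then show ?thesis using G(2) by (simp add: induced_edges_def)
qed

text \<open>
  Modulo the loads on \<open>S\<close>, the set \<open>S\<close> may be replaced by one of its vertices, so each member \<open>H\<close>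
  of a compatible family contributes at most \<open>2 * (card (H - S) + 1) - 3\<close> dimensions.
\<close>

lemma family_loads_spanning_set:
  assumes "finite \<H>" "\<And>H. H \<in> \<H> \<Longrightarrow> finite H \<and> S \<subset> H"
    and "finite S" "s \<in> S" "coincident_realisation S s p"
  obtains G where "finite G" "int (card G) \<le> family_val S \<H>" "eq_loads p S \<subseteq> span G"
    "\<forall>H\<in>\<H>. (\<exists>x\<in>H. p x \<noteq> p s) \<longrightarrow> eq_loads p H \<subseteq> span G"
proof -
  obtain G0 where G0: "finite G0" "card G0 + 2 \<le> 2 * card S" "eq_loads p S \<subseteq> span G0"
    using eq_loads_coincident_spanning_set[OF assms(3-5)] .
  have "\<exists>G. finite G \<and> int (card G) \<le> 2 * int (card (H - S)) - 1 \<and>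
      ((\<exists>x\<in>H. p x \<noteq> p s) \<longrightarrow> eq_loads p (insert s (H - S)) \<subseteq> span G)" if H: "H \<in> \<H>" for H
  proof (cases "\<exists>x\<in>H. p x \<noteq> p s")
    case True
    then obtain x where x: "x \<in> H" "p x \<noteq> p s" by blast
    then have "x \<notin> S" using assms(5) by (auto simp: coincident_realisation_def)
    then have m: "finite (insert s (H - S))" "x \<in> insert s (H - S)" "s \<in> insert s (H - S)"
      using assms(2)[OF H] x(1) by auto
    obtain G where G: "finite G" "card G + 3 \<le> 2 * card (insert s (H - S))"
        "eq_loads p (insert s (H - S)) \<subseteq> span G"
      using eq_loads_spanning_set[OF m x(2)] .
    moreover have "card (insert s (H - S)) = Suc (card (H - S))"
      using assms(2)[OF H] assms(4) by simp
    ultimately show ?thesis by (intro exI[of _ G]) auto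
  next
    case False
    have "card (H - S) > 0" using assms(2)[OF H] by (auto simp: card_gt_0_iff)
    with False show ?thesis by (intro exI[of _ "{}"]) simp
  qed
  then obtain g where g: "\<And>H. H \<in> \<H> \<Longrightarrow> finite (g H)"
    "\<And>H. H \<in> \<H> \<Longrightarrow> int (card (g H)) \<le> 2 * int (card (H - S)) - 1"
    "\<And>H x. H \<in> \<H> \<Longrightarrow> x \<in> H \<Longrightarrow> p x \<noteq> p s \<Longrightarrow> eq_loads p (insert s (H - S)) \<subseteq> span (g H)"
    by metis
  define G where "G = G0 \<union> (\<Union>H\<in>\<H>. g H)"
  show thesis
  proof (rule that)
    show "finite G" unfolding G_def using G0 g assms by auto
    have "card (\<Union>H\<in>\<H>. g H) \<le> (\<Sum>H\<in>\<H>. card (g H))" using assms by (intro card_UN_le)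
    then have "int (card G) \<le> int (card G0) + (\<Sum>H\<in>\<H>. int (card (g H)))"
      unfolding G_def using card_Un_le[of G0 "\<Union>H\<in>\<H>. g H"] by (simp flip: of_nat_sum of_nat_add)
    also have "(\<Sum>H\<in>\<H>. int (card (g H))) \<le> (\<Sum>H\<in>\<H>. 2 * int (card (H - S)) - 1)"
      using g by (intro sum_mono)
    finally show "int (card G) \<le> family_val S \<H>"
      using G0(2) by (simp add: family_val_def)
    show S: "eq_loads p S \<subseteq> span G" using G0(3) span_mono[of G0 G] by (auto simp: G_def)
    show "\<forall>H\<in>\<H>. (\<exists>x\<in>H. p x \<noteq> p s) \<longrightarrow> eq_loads p H \<subseteq> span G"
    proof (intro ballI impI)
      fix H assume H: "H \<in> \<H>" "\<exists>x\<in>H. p x \<noteq> p s"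
      have "span (g H) \<subseteq> span G" by (rule span_mono) (use H in \<open>auto simp: G_def\<close>)
      then have "eq_loads p (insert s (H - S)) \<subseteq> span G" using g(3)[OF H(1)] H(2) by blast
      then have "eq_loads p (insert s (H - S) \<union> S) \<subseteq> span G"
        using assms(3,4,5) S assms(2)[OF H(1)]
        by (intro eq_loads_union_coincident[of _ _ s]) auto
      moreover have "insert s (H - S) \<union> S = H" using assms(2)[OF H(1)] assms(4) by auto
      ultimately show "eq_loads p H \<subseteq> span G" by simp
    qed
  qed
qed

lemma coincident_realisation_subset:
  "coincident_realisation T t p \<Longrightarrow> S \<subseteq> T \<Longrightarrow> s \<in> T \<Longrightarrow> coincident_realisation S s p"
  unfolding coincident_realisation_def by (metis subsetD)

lemma simple_graphD:
  assumes "simple_graph V F"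
  shows "finite V" "finite F" "e \<in> F \<Longrightarrow> e \<subseteq> V" "e \<in> F \<Longrightarrow> card e = 2"
  using assms finite_subset[of F "Pow V"] by (auto simp: simple_graph_def)

lemma edge_loads_in_family_span:
  assumes "simple_graph V F" "D \<subseteq> {e \<in> F. \<exists>H\<in>\<H>. e \<subseteq> H}" "\<And>H. H \<in> \<H> \<Longrightarrow> finite H"
    and "\<And>e. e \<in> D \<Longrightarrow> edge_load p e \<noteq> 0"
    and "\<forall>H\<in>\<H>. (\<exists>x\<in>H. p x \<noteq> p s) \<longrightarrow> eq_loads p H \<subseteq> span G"
  shows "edge_load p ` D \<subseteq> span G"
proof
  fix f assume "f \<in> edge_load p ` D"
  then obtain e H where e: "f = edge_load p e" "e \<in> D" "e \<in> F" "H \<in> \<H>" "e \<subseteq> H"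
    using assms(2) by blast
  have c: "card e = 2" using e simple_graphD[OF assms(1)] by blast
  obtain a b where ab: "e = {a, b}" "p a \<noteq> p b"
    using edge_load_nonzero_imp_distinct[OF c] assms(4) e by metis
  then have "p a \<noteq> p s \<or> p b \<noteq> p s" by metis
  then have "eq_loads p H \<subseteq> span G" using assms(5) e(4,5) ab(1) by blast
  then show "f \<in> span G" using edge_load_in_eq_loads[OF assms(3)[OF e(4)] e(5) c] e(1) by blast
qed

text \<open>
  The spanning sets bound the number of independent rows.  Members of the family on which \<open>p\<close> is constant
  induce no edges, as the row of such an edge would be zero.
\<close>

theorem indep_imp_strongly_sparse:
  assumes F: "simple_graph V F" and T: "T \<subseteq> V" "coincident_realisation T t p"
    and ind: "indep_family F (edge_load p)"
  shows "strongly_sparse V F T"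
  unfolding strongly_sparse_def
proof (intro allI impI)
  fix S assume S: "S \<noteq> {}" "S \<subseteq> T"
  note Fs = simple_graphD[OF F]
  obtain s where s: "s \<in> S" using S by blast
  have coin: "coincident_realisation S s p"
    using coincident_realisation_subset[OF T(2)] S s by blast
  show "S_sparse V F S"
    unfolding S_sparse_def
  proof (intro conjI allI impI)
    fix X assume X: "X \<subseteq> V" "2 \<le> card X"
    show "int (induced_edges F X) \<le> set_val S X"
    proof (cases "X \<subseteq> S")
      case True
      have "\<not> e \<subseteq> X" if e: "e \<in> F" for e
      proof
        assume eX: "e \<subseteq> X"
        obtain a b where "e = {a, b}" "p a \<noteq> p b"
          using edge_load_nonzero_imp_distinct Fs(4)[OF e] indep_family_nonzero[OF Fs(2) ind e] by metis
        then show False using eX True coin unfolding coincident_realisation_def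
          by (metis insert_subset subsetD)
      qed
      then have none: "{e \<in> F. e \<subseteq> X} = {}" by blast
      show ?thesis unfolding induced_edges_def none set_val_def using True by simp
    next
      case False
      then show ?thesis
        using indep_imp_induced_edges_le[OF Fs(2,4) ind _ X(2)] X Fs(1) finite_subset
        by (auto simp: set_val_def)
    qed
  next
    fix \<H> assume H: "compatible_family V S \<H>"
    have fin: "finite \<H>" "\<And>H. H \<in> \<H> \<Longrightarrow> finite H \<and> S \<subset> H"
      using H Fs(1) finite_subset[of \<H> "Pow V"] finite_subset[of _ V]
      by (auto simp: compatible_family_def)
    have fS: "finite S" using S T(1) Fs(1) by (meson finite_subset)
    obtain G where
      G: "finite G" "int (card G) \<le> family_val S \<H>" and G': "eq_loads p S \<subseteq> span G"
      "\<forall>H\<in>\<H>. (\<exists>x\<in>H. p x \<noteq> p s) \<longrightarrow> eq_loads p H \<subseteq> span G"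
      by (rule family_loads_spanning_set[OF fin fS s coin])
    let ?D = "{e \<in> F. \<exists>X\<in>\<H>. e \<subseteq> X}"
    have "edge_load p ` ?D \<subseteq> span G"
      using edge_loads_in_family_span[OF F order_refl _ _ G'(2)] fin(2)
        indep_family_nonzero[OF Fs(2) ind] by blast
    moreover have "indep_family ?D (edge_load p)"
      by (rule indep_family_mono[OF Fs(2) _ ind]) auto
    ultimately have "card ?D \<le> card G"
      using indep_family_card_le[of ?D "edge_load p" G] Fs(2) G(1) by auto
    then show "int (family_induced_edges F \<H>) \<le> family_val S \<H>"
      using G(2) by (simp add: family_induced_edges_def)
  qed
qed

section \<open>Generic coincident realisations\<close>

text \<open>
  The consequences of algebraic independence that the rest of the proof relies on.  The
  assumption \<open>independent_if_somewhere\<close> is genericity in the sense of matroids.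
\<close>

locale generic_coincident_framework =
  fixes V T :: "'v set" and t :: 'v and p :: "'v \<Rightarrow> real ^ 2"
  assumes finite_V: "finite V" and T_subset: "T \<subseteq> V" and t_in_T: "t \<in> T"
    and coincident: "coincident_realisation T t p"
    and independent_if_somewhere:
      "\<And>q F. simple_graph V F \<Longrightarrow> coincident_realisation T t q \<Longrightarrow>
         indep_family F (edge_load q) \<Longrightarrow> indep_family F (edge_load p)"
    and noncollinear:
      "\<And>x y z. {x, y, z} \<subseteq> V \<Longrightarrow> card {x, y, z} = 3 \<Longrightarrow> card ({x, y, z} \<inter> T) \<le> 1 \<Longrightarrow>
         cross2 (p x - p z) (p y - p z) \<noteq> 0"
    and distinct_points: "\<And>x y. {x, y} \<subseteq> V \<Longrightarrow> x \<noteq> y \<Longrightarrow> \<not> {x, y} \<subseteq> T \<Longrightarrow> p x \<noteq> p y"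

lemma indep_family_cong: "(\<And>k. k \<in> K \<Longrightarrow> g k = h k) \<Longrightarrow> indep_family K g = indep_family K h"
  unfolding indep_family_def by (simp cong: sum.cong)

text \<open>
  Realisations that are coincident on \<open>T\<close> are parametrised by the coordinates of the vertices
  outside \<open>T - {t}\<close>, and the rigidity matrix is polynomial in these.
\<close>

lemma generic_coincident_realisation_framework:
  fixes V T :: "'v set" and p :: "'v \<Rightarrow> real ^ 2"
  assumes V: "finite V" "T \<subseteq> V" "t \<in> T" and gen: "generic_coincident_realisation V T t p"
  shows "generic_coincident_framework V T t p"
proof -
  define rep where "rep v = (if v \<in> T then t else v)" for v
  define pos :: "('v \<times> 2 \<Rightarrow> real) \<Rightarrow> 'v \<Rightarrow> real ^ 2" where "pos x v = (\<chi> i. x (rep v, i))" for x v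
  define crd :: "('v \<Rightarrow> real ^ 2) \<Rightarrow> 'v \<times> 2 \<Rightarrow> real" where "crd q = (\<lambda>(v, i). q v $ i)" for q
  define I where "I = (V - (T - {t})) \<times> (UNIV :: 2 set)"
  have coin: "coincident_realisation T t p" and alg: "alg_indep_over_rat I (crd p)"
    using gen by (simp_all add: generic_coincident_realisation_def I_def crd_def)
  have pos_crd: "pos (crd q) = q" if "coincident_realisation T t q" for q
    using that unfolding coincident_realisation_def by (auto simp: pos_def crd_def rep_def fun_eq_iff)
  have pos_poly: "(\<lambda>x. pos x v $ i) \<in> poly_functions I" if "v \<in> V" for v i
    unfolding pos_def using that V by (auto simp: I_def rep_def intro!: poly_functions.var)
  show ?thesis
  proof
    fix q F assume F: "simple_graph V F" and q: "coincident_realisation T t q" "indep_family F (edge_load q)"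
    note Fs = simple_graphD[OF F]
    note iff = rows_independent_iff_indep_family[OF Fs(3)]
    have "rows_independent F (V \<times> UNIV) (\<lambda>e c. rigidity_matrix (pos (crd p)) e c)"
    proof (rule rows_independent_at_generic_point[OF alg])
      fix e and c :: "'v \<times> 2" assume e: "e \<in> F" and c: "c \<in> V \<times> UNIV"
      obtain v i where vi: "c = (v, i)" by (cases c)
      show "(\<lambda>x. rigidity_matrix (pos x) e c) \<in> poly_functions I"
      proof (cases "v \<in> e")
        case True
        then obtain w where w: "e = {v, w}" "v \<noteq> w"
          using Fs(4)[OF e] by (auto simp: card_2_iff)
        have "rigidity_matrix (pos x) e c = edge_load (pos x) e v $ i" for x
          by (simp add: edge_load_def vi)
        then have "(\<lambda>x. rigidity_matrix (pos x) e c) = (\<lambda>x. pos x v $ i - pos x w $ i)"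
          by (simp add: w edge_load_endpoint)
        then show ?thesis using Fs(3)[OF e] w by (simp add: poly_functions_diff pos_poly)
      next
        case False
        then show ?thesis using poly_functions.const[of 0] by (simp add: vi rigidity_matrix_def)
      qed
    next
      show "rows_independent F (V \<times> UNIV) (\<lambda>e c. rigidity_matrix (pos (crd q)) e c)"
        using q iff[where p = q] by (simp add: pos_crd)
    qed (use Fs in auto)
    then show "indep_family F (edge_load p)" using iff[where p = p] by (simp add: pos_crd[OF coin])
  next
    fix x y z assume xyz: "{x, y, z} \<subseteq> V" "card {x, y, z} = 3" "card ({x, y, z} \<inter> T) \<le> 1"
    have d: "x \<noteq> y" "x \<noteq> z" "y \<noteq> z"
      using xyz(2) by (auto simp: card_insert_if split: if_splits)
    have no_two: "\<not> {u, v} \<subseteq> T" if "u \<noteq> v" "{u, v} \<subseteq> {x, y, z}" for u v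
    proof
      assume "{u, v} \<subseteq> T"
      then have "card {u, v} \<le> card ({x, y, z} \<inter> T)" using that by (intro card_mono) auto
      with xyz(3) that(1) show False by simp
    qed
    have rd: "rep x \<noteq> rep y" "rep x \<noteq> rep z" "rep y \<noteq> rep z"
      using no_two[of x y] no_two[of x z] no_two[of y z] d V(3) by (auto simp: rep_def split: if_splits)
    \<comment> \<open>A witness: \<open>x\<close> and \<open>y\<close> at the unit vectors, everything else at the origin.\<close>
    define y0 :: "'v \<times> 2 \<Rightarrow> real" where
      "y0 = (\<lambda>(v, i). if v = rep x \<and> i = 1 \<or> v = rep y \<and> i = 2 then 1 else 0)"
    let ?f = "\<lambda>c. cross2 (pos c x - pos c z) (pos c y - pos c z)"
    have "?f \<in> poly_functions I"
      unfolding cross2_def vector_minus_component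
      using xyz(1) by (intro poly_functions_diff poly_functions.mult pos_poly) auto
    moreover have "?f y0 \<noteq> 0"
      using rd by (simp add: cross2_def pos_def y0_def)
    ultimately have "?f (crd p) \<noteq> 0" by (rule poly_function_nonzero_at_generic_point[OF alg])
    then show "cross2 (p x - p z) (p y - p z) \<noteq> 0" by (simp add: pos_crd[OF coin])
  next
    fix x y assume xy: "{x, y} \<subseteq> V" "x \<noteq> y" "\<not> {x, y} \<subseteq> T"
    then have rd: "rep x \<noteq> rep y" using V(3) by (auto simp: rep_def)
    define y0 :: "'v \<times> 2 \<Rightarrow> real" where "y0 = (\<lambda>(v, i). if v = rep x then 1 else 0)"
    let ?f = "\<lambda>c. pos c x $ 1 - pos c y $ 1"
    have "?f \<in> poly_functions I" using xy by (intro poly_functions_diff pos_poly) auto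
    moreover have "?f y0 \<noteq> 0" using rd by (simp add: pos_def y0_def)
    ultimately have "?f (crd p) \<noteq> 0" by (rule poly_function_nonzero_at_generic_point[OF alg])
    then show "p x \<noteq> p y" by (auto simp: pos_crd[OF coin])
  qed (use V coin in auto)
qed

section \<open>Adding a vertex\<close>

definition nbrs :: "'v set set \<Rightarrow> 'v \<Rightarrow> 'v set" where
  "nbrs E v = {x. {v, x} \<in> E}"

lemma nbrsD:
  assumes "simple_graph V E"
  shows "nbrs E v \<subseteq> V" "v \<notin> nbrs E v" "finite (nbrs E v)"
    "{e \<in> E. v \<in> e} = (\<lambda>x. {v, x}) ` nbrs E v" "inj_on (\<lambda>x. {v, x}) (nbrs E v)"
    "card {e \<in> E. v \<in> e} = card (nbrs E v)"
proof -
  note Es = simple_graphD[OF assms]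
  show sub: "nbrs E v \<subseteq> V" using Es(3) by (auto simp: nbrs_def)
  show "v \<notin> nbrs E v" using Es(4)[of "{v, v}"] by (auto simp: nbrs_def)
  show "finite (nbrs E v)" using sub Es(1) by (rule finite_subset)
  show inj: "inj_on (\<lambda>x. {v, x}) (nbrs E v)" by (auto simp: inj_on_def doubleton_eq_iff)
  show im: "{e \<in> E. v \<in> e} = (\<lambda>x. {v, x}) ` nbrs E v"
  proof
    show "{e \<in> E. v \<in> e} \<subseteq> (\<lambda>x. {v, x}) ` nbrs E v"
    proof
      fix e assume e: "e \<in> {e \<in> E. v \<in> e}"
      then obtain a b where ab: "e = {a, b}" using Es(4)[of e] by (auto simp: card_2_iff)
      with e have "e = {v, a} \<or> e = {v, b}" by auto
      with e show "e \<in> (\<lambda>x. {v, x}) ` nbrs E v" by (auto simp: nbrs_def)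
    qed
  qed (auto simp: nbrs_def)
  show "card {e \<in> E. v \<in> e} = card (nbrs E v)" by (simp add: im card_image[OF inj])
qed

lemma sum_edges_split_at_vertex:
  fixes g :: "'v set \<Rightarrow> 'b::comm_monoid_add"
  assumes "simple_graph V E"
  shows "(\<Sum>e\<in>E. g e) = (\<Sum>e\<in>{e \<in> E. v \<notin> e}. g e) + (\<Sum>x\<in>nbrs E v. g {v, x})"
proof -
  have "(\<Sum>e\<in>E. g e) = (\<Sum>e\<in>{e \<in> E. v \<notin> e} \<union> {e \<in> E. v \<in> e}. g e)"
    by (intro sum.cong) auto
  also have "\<dots> = (\<Sum>e\<in>{e \<in> E. v \<notin> e}. g e) + (\<Sum>e\<in>{e \<in> E. v \<in> e}. g e)"
    using simple_graphD(2)[OF assms] by (intro sum.union_disjoint) auto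
  finally show ?thesis by (simp add: nbrsD(4)[OF assms] sum.reindex[OF nbrsD(5)[OF assms]])
qed

lemma sum_edge_loads_at_vertex:
  assumes E: "simple_graph V E"
  shows "(\<Sum>e\<in>E. a e *\<^sub>R edge_load q e) v = (\<Sum>x\<in>nbrs E v. a {v, x} *\<^sub>R (q v - q x))"
proof -
  have "(\<Sum>e\<in>E. a e *\<^sub>R edge_load q e) v =
      (\<Sum>e\<in>{e \<in> E. v \<notin> e}. a e *\<^sub>R edge_load q e v) + (\<Sum>x\<in>nbrs E v. a {v, x} *\<^sub>R edge_load q {v, x} v)"
    by (simp add: sum_apply sum_edges_split_at_vertex[OF E, of _ v])
  also have "(\<Sum>e\<in>{e \<in> E. v \<notin> e}. a e *\<^sub>R edge_load q e v) = 0"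
    by (intro sum.neutral) (auto simp: edge_load_outside)
  also have "(\<Sum>x\<in>nbrs E v. a {v, x} *\<^sub>R edge_load q {v, x} v) = (\<Sum>x\<in>nbrs E v. a {v, x} *\<^sub>R (q v - q x))"
  proof (rule sum.cong[OF refl])
    fix x assume "x \<in> nbrs E v"
    then have "v \<noteq> x" using nbrsD(2)[OF E, of v] by auto
    then show "a {v, x} *\<^sub>R edge_load q {v, x} v = a {v, x} *\<^sub>R (q v - q x)"
      by (simp add: edge_load_endpoint)
  qed
  finally show ?thesis by (simp only: add_0)
qed

lemma forces_at_vertex_balance:
  assumes "simple_graph V E" "(\<Sum>e\<in>E. a e *\<^sub>R edge_load q e) = 0"
  shows "(\<Sum>x\<in>nbrs E v. a {v, x} *\<^sub>R (q v - q x)) = 0"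
  using sum_edge_loads_at_vertex[OF assms(1), of a q v] unfolding assms(2) by simp

lemma indep_if_independent_at_vertex:
  assumes E: "simple_graph V E" and F: "indep_family {e \<in> E. v \<notin> e} (edge_load q)"
    and N: "indep_family (nbrs E v) (\<lambda>x. q v - q x)"
  shows "indep_family E (edge_load q)"
proof (rule indep_familyI)
  fix a e assume a: "(\<Sum>e\<in>E. a e *\<^sub>R edge_load q e) = 0" and e: "e \<in> E"
  have "(\<Sum>x\<in>nbrs E v. a {v, x} *\<^sub>R (q v - q x)) = 0"
    by (rule forces_at_vertex_balance[OF E a])
  then have N0: "a {v, x} = 0" if "x \<in> nbrs E v" for x
    using indep_familyD[OF N, of "\<lambda>x. a {v, x}"] that by simp
  then have "(\<Sum>e\<in>{e \<in> E. v \<notin> e}. a e *\<^sub>R edge_load q e) = 0"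
    using a sum_edges_split_at_vertex[OF E, of "\<lambda>e. a e *\<^sub>R edge_load q e" v] by simp
  then have F0: "a e = 0" if "e \<in> E" "v \<notin> e" for e using indep_familyD[OF F] that by blast
  show "a e = 0"
  proof (cases "v \<in> e")
    case True
    then have "e \<in> (\<lambda>x. {v, x}) ` nbrs E v" using e nbrsD(4)[OF E, of v] by auto
    then show ?thesis using N0 by auto
  qed (use F0 e in auto)
qed

text \<open>
  At the midpoint of \<open>xy\<close> the forces on \<open>v\<close> are balanced only if \<open>vz\<close> carries none and the loads of \<open>vx\<close> and
  \<open>vy\<close> combine to a multiple of the load of \<open>xy\<close>, which is independent of the rest.
\<close>

lemma indep_if_subdivided_edge:
  assumes E: "simple_graph V E" and N: "nbrs E v = {x, y, z}" "card {x, y, z} = 3"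
    and xy: "indep_family (insert {x, y} {e \<in> E. v \<notin> e}) (edge_load q)" "{x, y} \<notin> E"
    and mid: "q v = (1 / 2) *\<^sub>R (q x + q y)" and col: "cross2 (q x - q z) (q y - q z) \<noteq> 0"
  shows "indep_family E (edge_load q)"
proof (rule indep_familyI)
  let ?F = "{e \<in> E. v \<notin> e}"
  fix a e assume a: "(\<Sum>e\<in>E. a e *\<^sub>R edge_load q e) = 0" and e: "e \<in> E"
  have d: "x \<noteq> y" "x \<noteq> z" "y \<noteq> z" using N(2) by (auto simp: card_insert_if split: if_splits)
  have v: "v \<noteq> x" "v \<noteq> y" "v \<noteq> z" using nbrsD(2)[OF E, of v] N(1) by auto
  have sumN: "(\<Sum>x\<in>nbrs E v. g x) = g x + (g y + g z)" for g :: "'a \<Rightarrow> 'b::comm_monoid_add"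
    using d by (simp add: N(1))
  let ?\<alpha> = "q x - q z" and ?\<beta> = "q y - q z"
  have bal: "a {v, x} *\<^sub>R (q v - q x) + (a {v, y} *\<^sub>R (q v - q y) + a {v, z} *\<^sub>R (q v - q z)) = 0"
    using forces_at_vertex_balance[OF E a, of v] by (simp only: sumN)
  have vx: "q v - q x = (1 / 2) *\<^sub>R (?\<beta> - ?\<alpha>)" "q v - q y = - (1 / 2) *\<^sub>R (?\<beta> - ?\<alpha>)"
    "q v - q z = (1 / 2) *\<^sub>R (?\<alpha> + ?\<beta>)"
    by (simp_all add: mid vec2_eq_iff field_simps)
  have "cross2 (?\<beta> - ?\<alpha>) (a {v, x} *\<^sub>R (q v - q x) + (a {v, y} *\<^sub>R (q v - q y) + a {v, z} *\<^sub>R (q v - q z)))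
      = - a {v, z} * cross2 ?\<alpha> ?\<beta>"
    unfolding vx by (simp add: cross2_def field_simps)
  then have az: "a {v, z} = 0" using bal col by (simp add: cross2_linear(4))
  have nz: "?\<beta> - ?\<alpha> \<noteq> 0" using col cross2_linear(8) by (metis right_minus_eq)
  have "((a {v, x} - a {v, y}) / 2) *\<^sub>R (?\<beta> - ?\<alpha>) = 0"
    using bal az unfolding vx by (simp add: vec2_eq_iff field_simps)
  then have ayx: "a {v, y} = a {v, x}" using nz by simp
  have comb: "edge_load q {v, x} + edge_load q {v, y} = (1 / 2) *\<^sub>R edge_load q {x, y}"
    using d v by (auto simp: fun_eq_iff edge_load_conv_point_load point_load_def mid vec2_eq_iff field_simps)
  have notF: "{x, y} \<notin> ?F" using xy(2) by simp
  have finF: "finite ?F" using simple_graphD(2)[OF E] by simp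
  define b where "b e = (if e = {x, y} then a {v, x} / 2 else a e)" for e
  have "(\<Sum>e\<in>insert {x, y} ?F. b e *\<^sub>R edge_load q e) =
      (a {v, x} / 2) *\<^sub>R edge_load q {x, y} + (\<Sum>e\<in>?F. b e *\<^sub>R edge_load q e)"
    using notF finF by (simp add: b_def)
  also have "(\<Sum>e\<in>?F. b e *\<^sub>R edge_load q e) = (\<Sum>e\<in>?F. a e *\<^sub>R edge_load q e)"
    using xy(2) by (intro sum.cong) (auto simp: b_def)
  also have "(a {v, x} / 2) *\<^sub>R edge_load q {x, y} =
      a {v, x} *\<^sub>R (edge_load q {v, x} + edge_load q {v, y})"
    by (simp add: comb)
  also have "\<dots> + (\<Sum>e\<in>?F. a e *\<^sub>R edge_load q e) = (\<Sum>e\<in>E. a e *\<^sub>R edge_load q e)"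
    using sum_edges_split_at_vertex[OF E, of "\<lambda>e. a e *\<^sub>R edge_load q e" v]
    by (simp only: sumN az ayx scaleR_add_right scaleR_zero_left add_0_right add_0 ac_simps)
  finally have b0: "(\<Sum>e\<in>insert {x, y} ?F. b e *\<^sub>R edge_load q e) = 0" by (simp only: a)
  have "b {x, y} = 0" using indep_familyD[OF xy(1) b0] by blast
  then have "a {v, x} = 0" by (simp add: b_def)
  with ayx az have N0: "a {v, u} = 0" if "u \<in> nbrs E v" for u using that N(1) by auto
  show "a e = 0"
  proof (cases "v \<in> e")
    case True
    then have "e \<in> (\<lambda>x. {v, x}) ` nbrs E v" using e nbrsD(4)[OF E, of v] by auto
    then show ?thesis using N0 by auto
  next
    case False
    have "e \<noteq> {x, y}" using e xy(2) by auto
    moreover have "b e = 0" using indep_familyD[OF xy(1) b0] False e by blast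
    ultimately show ?thesis by (simp add: b_def)
  qed
qed

text \<open>
  Eliminating a vertex with two coincident neighbours \<open>r\<close> and \<open>s\<close> leaves the difference of its two
  edge loads: opposite forces at \<open>r\<close> and \<open>s\<close> in the direction of the new vertex.
\<close>

lemma indep_if_coincident_neighbours:
  assumes E: "simple_graph V E" and F: "indep_family {e \<in> E. v \<notin> e} (edge_load q)"
    and N: "nbrs E v = insert r N" "r \<notin> N" "s \<in> N" "indep_family N (\<lambda>x. q v - q x)"
    and rs: "q r = q s"
    and out: "point_load s (q v - q s) - point_load r (q v - q s) \<notin> span (edge_load q ` {e \<in> E. v \<notin> e})"
  shows "indep_family E (edge_load q)"
proof (rule indep_familyI)
  let ?F = "{e \<in> E. v \<notin> e}"
  fix a e assume a: "(\<Sum>e\<in>E. a e *\<^sub>R edge_load q e) = 0" and e: "e \<in> E"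
  have finN: "finite N" using nbrsD(3)[OF E, of v] N(1) by auto
  have v: "v \<noteq> r" "v \<noteq> s" using nbrsD(2)[OF E, of v] N(1,3) by auto
  \<comment> \<open>Seen from \<open>v\<close>, the coincident neighbours \<open>r\<close> and \<open>s\<close> act as one.\<close>
  define b where "b x = a {v, x} + (if x = s then a {v, r} else 0)" for x
  have "(\<Sum>x\<in>N. b x *\<^sub>R (q v - q x)) =
      (\<Sum>x\<in>N. a {v, x} *\<^sub>R (q v - q x)) + (\<Sum>x\<in>N. if x = s then a {v, r} *\<^sub>R (q v - q s) else 0)"
    unfolding sum.distrib[symmetric] b_def by (intro sum.cong) (auto simp: scaleR_add_left)
  also have "\<dots> = (\<Sum>x\<in>nbrs E v. a {v, x} *\<^sub>R (q v - q x))"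
    using finN N(2,3) rs by (simp add: N(1) sum.delta add.commute)
  also have "\<dots> = 0" by (rule forces_at_vertex_balance[OF E a])
  finally have "b x = 0" if "x \<in> N" for x using indep_familyD[OF N(4)] that by blast
  note b0 = this
  have aN: "a {v, x} = 0" if "x \<in> N" "x \<noteq> s" for x
    using b0[OF that(1)] that(2) by (simp add: b_def)
  have "a {v, s} + a {v, r} = 0" using b0[OF N(3)] by (simp add: b_def)
  then have as: "a {v, s} = - a {v, r}" by linarith
  have comb: "edge_load q {v, r} - edge_load q {v, s} =
      point_load s (q v - q s) - point_load r (q v - q s)"
    using v rs by (auto simp: fun_eq_iff edge_load_conv_point_load point_load_def)
  have "(\<Sum>x\<in>nbrs E v. a {v, x} *\<^sub>R edge_load q {v, x}) =
      a {v, r} *\<^sub>R edge_load q {v, r} + (\<Sum>x\<in>N. a {v, x} *\<^sub>R edge_load q {v, x})"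
    using finN N(2) by (simp add: N(1))
  also have "(\<Sum>x\<in>N. a {v, x} *\<^sub>R edge_load q {v, x}) =
      (\<Sum>x\<in>N. if x = s then - a {v, r} *\<^sub>R edge_load q {v, s} else 0)"
    using aN as by (intro sum.cong) auto
  also have "\<dots> = - a {v, r} *\<^sub>R edge_load q {v, s}" using finN N(3) by (simp add: sum.delta)
  finally have star: "(\<Sum>x\<in>nbrs E v. a {v, x} *\<^sub>R edge_load q {v, x}) =
      a {v, r} *\<^sub>R (point_load s (q v - q s) - point_load r (q v - q s))"
    by (simp only: comb[symmetric] scaleR_diff_right scaleR_minus_left add_uminus_conv_diff)
  have eq: "(\<Sum>e\<in>?F. a e *\<^sub>R edge_load q e) +
      a {v, r} *\<^sub>R (point_load s (q v - q s) - point_load r (q v - q s)) = 0"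
    using a sum_edges_split_at_vertex[OF E, of "\<lambda>e. a e *\<^sub>R edge_load q e" v] star by simp
  have ar: "a {v, r} = 0"
  proof (rule ccontr)
    let ?w = "point_load s (q v - q s) - point_load r (q v - q s)"
    assume nz: "a {v, r} \<noteq> 0"
    have w: "a {v, r} *\<^sub>R ?w = - (\<Sum>e\<in>?F. a e *\<^sub>R edge_load q e)"
      by (rule minus_unique[OF eq, symmetric])
    have "- (\<Sum>e\<in>?F. a e *\<^sub>R edge_load q e) \<in> span (edge_load q ` ?F)"
      by (intro span_neg span_sum span_scale span_base) auto
    then have "(1 / a {v, r}) *\<^sub>R (a {v, r} *\<^sub>R ?w) \<in> span (edge_load q ` ?F)"
      unfolding w by (rule span_scale)
    moreover have "(1 / a {v, r}) *\<^sub>R (a {v, r} *\<^sub>R ?w) = ?w"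
      using nz by (simp only: scaleR_scaleR) simp
    ultimately show False using out by simp
  qed
  with eq have F0: "a e = 0" if "e \<in> ?F" for e using indep_familyD[OF F] that by auto
  have N0: "a {v, u} = 0" if "u \<in> nbrs E v" for u
    using that N(1) ar as aN by (cases "u = s") auto
  show "a e = 0"
  proof (cases "v \<in> e")
    case True
    then have "e \<in> (\<lambda>x. {v, x}) ` nbrs E v" using e nbrsD(4)[OF E, of v] by auto
    then show ?thesis using N0 by auto
  qed (use F0 e in auto)
qed

lemma indep_family_singleton: "g k \<noteq> 0 \<Longrightarrow> indep_family {k} g"
  by (simp add: indep_family_def)

lemma indep_family_pair:
  assumes "cross2 (g x) (g y) \<noteq> 0"
  shows "indep_family {x, y} g"
proof -
  have xy: "x \<noteq> y" using assms cross2_linear(8) by metis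
  show ?thesis
  proof (rule indep_familyI)
    fix a k assume "(\<Sum>k\<in>{x, y}. a k *\<^sub>R g k) = 0" and k: "k \<in> {x, y}"
    then have eq: "a x *\<^sub>R g x + a y *\<^sub>R g y = 0" using xy by simp
    have "cross2 (g x) (a x *\<^sub>R g x + a y *\<^sub>R g y) = a y * cross2 (g x) (g y)"
      "cross2 (g y) (a x *\<^sub>R g x + a y *\<^sub>R g y) = - a x * cross2 (g x) (g y)"
      by (simp_all add: cross2_def algebra_simps)
    then show "a k = 0" using eq assms k by (auto simp: cross2_linear(4))
  qed
qed

lemma two_distinct_elements:
  assumes "2 \<le> card Y"
  obtains x y where "x \<in> Y" "y \<in> Y" "x \<noteq> y"
proof -
  obtain Z where "Z \<subseteq> Y" "card Z = 2" using obtain_subset_with_card_n[OF assms] by metis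
  then show ?thesis using that by (auto simp: card_2_iff)
qed

lemma edge_load_fun_upd: "v \<notin> e \<Longrightarrow> card e = 2 \<Longrightarrow> edge_load (p(v := a)) e = edge_load p e"
  by (rule edge_load_cong) auto

context generic_coincident_framework
begin

lemma coincident_fun_upd:
  assumes "v \<notin> T"
  shows "coincident_realisation T t (p(v := a))"
  unfolding coincident_realisation_def
proof
  fix x assume x: "x \<in> T"
  have "p x = p t" using coincident x unfolding coincident_realisation_def by (rule bspec)
  moreover have "x \<noteq> v" "t \<noteq> v" using assms x t_in_T by auto
  ultimately show "(p(v := a)) x = (p(v := a)) t" by simp
qed

lemma indep_small_star:
  assumes E: "simple_graph V E" and v: "v \<in> V" "card (nbrs E v) \<le> 2"
    and T: "card (insert v (nbrs E v) \<inter> T) \<le> 1"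
    and F: "indep_family {e \<in> E. v \<notin> e} (edge_load p)"
  shows "indep_family E (edge_load p)"
proof (rule indep_if_independent_at_vertex[OF E F])
  note N = nbrsD[OF E, of v]
  consider "nbrs E v = {}" | x where "nbrs E v = {x}" | x y where "nbrs E v = {x, y}" "x \<noteq> y"
  proof -
    have "card (nbrs E v) = 0 \<or> card (nbrs E v) = 1 \<or> card (nbrs E v) = 2" using v by linarith
    then show thesis using that N(3) by (auto simp: card_1_singleton_iff card_2_iff)
  qed
  then show "indep_family (nbrs E v) (\<lambda>x. p v - p x)"
  proof cases
    case 1
    then show ?thesis by simp
  next
    case (2 x)
    then have "v \<noteq> x" "x \<in> V" using N by auto
    moreover have "\<not> {v, x} \<subseteq> T"
    proof
      assume "{v, x} \<subseteq> T"
      then have "insert v (nbrs E v) \<inter> T = {v, x}" using 2 by auto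
      then show False using T \<open>v \<noteq> x\<close> by simp
    qed
    ultimately have "p v \<noteq> p x" using distinct_points v by auto
    then show ?thesis unfolding 2 by (intro indep_family_singleton) simp
  next
    case (3 x y)
    then have d: "v \<noteq> x" "x \<in> V" "v \<noteq> y" "y \<in> V" using N by auto
    have "cross2 (p x - p v) (p y - p v) \<noteq> 0"
      by (rule noncollinear) (use d v 3 T in \<open>auto simp: insert_commute\<close>)
    then have "cross2 (p v - p x) (p v - p y) \<noteq> 0" by (simp add: cross2_def algebra_simps)
    then show ?thesis unfolding 3 by (rule indep_family_pair)
  qed
qed

text \<open>
  Starting from one edge, each further vertex is joined to two earlier ones.  Three vertices of \<open>Y\<close> are
  never collinear because at most one of them is in \<open>T\<close>.
\<close>

lemma laman_basis_on_set:
  assumes "finite Y" "Y \<subseteq> V" "2 \<le> card Y" "card (Y \<inter> T) \<le> 1"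
  shows "\<exists>B. finite B \<and> (\<forall>e\<in>B. e \<subseteq> Y \<and> card e = 2) \<and> indep_family B (edge_load p) \<and> card B + 3 = 2 * card Y"
  using assms
proof (induction Y rule: finite_remove_induct)
  case empty
  then show ?case by simp
next
  case (remove Y)
  show ?case
  proof (cases "card Y = 2")
    case True
    then obtain a b where ab: "Y = {a, b}" "a \<noteq> b" by (auto simp: card_2_iff)
    have "\<not> Y \<subseteq> T"
    proof
      assume "Y \<subseteq> T"
      then have "Y \<inter> T = Y" by blast
      then show False using remove.prems True by simp
    qed
    then have "p a \<noteq> p b" using distinct_points[of a b] remove.prems(1) ab by auto
    then have "edge_load p Y a \<noteq> 0"
      unfolding ab(1) edge_load_endpoint[OF ab(2)] by simp
    then have "edge_load p Y \<noteq> 0" by (rule contrapos_nn) simp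
    then have "indep_family {Y} (edge_load p)" by (rule indep_family_singleton)
    moreover have "finite {Y}" "\<forall>e\<in>{Y}. e \<subseteq> Y \<and> card e = 2" "card {Y} + 3 = 2 * card Y"
      using True by simp_all
    ultimately show ?thesis by blast
  next
    case False
    then have c3: "card Y \<ge> 3" using remove.prems by linarith
    then obtain v where v: "v \<in> Y" by fastforce
    have cv: "card (Y - {v}) = card Y - 1" using v remove.hyps by simp
    have "card ((Y - {v}) \<inter> T) \<le> card (Y \<inter> T)" using remove.hyps by (intro card_mono) auto
    then have "Y - {v} \<subseteq> V" "2 \<le> card (Y - {v})" "card ((Y - {v}) \<inter> T) \<le> 1"
      using remove.prems c3 cv by auto
    from remove.IH[OF v this] obtain B where B: "finite B" "\<forall>e\<in>B. e \<subseteq> Y - {v} \<and> card e = 2"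
      "indep_family B (edge_load p)" "card B + 3 = 2 * card (Y - {v})" by blast
    obtain x y where xy: "x \<in> Y - {v}" "y \<in> Y - {v}" "x \<noteq> y"
      by (rule two_distinct_elements[of "Y - {v}"]) (use c3 cv in simp_all)
    define B' where "B' = insert {v, x} (insert {v, y} B)"
    have simp: "simple_graph V B'"
      unfolding simple_graph_def B'_def using finite_V B(2) v xy remove.prems(1) by force
    have vB: "v \<notin> e" if "e \<in> B" for e using B(2) that by blast
    then have new: "{v, x} \<notin> B" "{v, y} \<notin> B" by blast+
    have star: "{e \<in> B'. v \<notin> e} = B" using vB by (auto simp: B'_def)
    have nb: "nbrs B' v = {x, y}"
      using vB by (fastforce simp: nbrs_def B'_def doubleton_eq_iff)
    have "card (insert v (nbrs B' v) \<inter> T) \<le> card (Y \<inter> T)"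
      unfolding nb using v xy remove.hyps(1) by (intro card_mono) auto
    then have "indep_family B' (edge_load p)"
      using indep_small_star[OF simp, of v] subsetD[OF remove.prems(1) v] xy(3) nb star B(3)
        remove.prems(3) by simp
    moreover have "card B' = card B + 2"
      using B(1) new xy by (simp add: B'_def doubleton_eq_iff)
    moreover have "\<forall>e\<in>B'. e \<subseteq> Y \<and> card e = 2"
      using B(2) v xy by (force simp: B'_def)
    moreover have "finite B'" using B(1) by (simp add: B'_def)
    ultimately show ?thesis using B(4) c3 cv by (intro exI[of _ B']) auto
  qed
qed

text \<open>
  A Laman basis on \<open>Y\<close> has at least as many elements as a spanning set of \<open>eq_loads p Y\<close>, so it spans this space.
\<close>

lemma eq_loads_subset_if_all_edges:
  assumes Y: "Y \<subseteq> V" "2 \<le> card Y" "card (Y \<inter> T) \<le> 1"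
    and "\<And>e. e \<subseteq> Y \<Longrightarrow> card e = 2 \<Longrightarrow> edge_load p e \<in> span D"
  shows "eq_loads p Y \<subseteq> span D"
proof -
  have fin: "finite Y" using Y(1) finite_V by (rule finite_subset)
  from laman_basis_on_set[OF fin Y] obtain B where B: "finite B" "\<forall>e\<in>B. e \<subseteq> Y \<and> card e = 2"
    "indep_family B (edge_load p)" "card B + 3 = 2 * card Y" by blast
  have "card B \<noteq> 0" using B(4) by presburger
  then have "B \<noteq> {}" by auto
  then obtain e where e: "e \<in> B" by blast
  have c: "card e = 2" using B(2) e by blast
  obtain a b where ab: "e = {a, b}" "p a \<noteq> p b"
    using edge_load_nonzero_imp_distinct[OF c indep_family_nonzero[OF B(1,3) e]] .
  have m: "a \<in> Y" "b \<in> Y" using B(2) e ab(1) by auto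
  obtain G where G: "finite G" "card G + 3 \<le> 2 * card Y" "eq_loads p Y \<subseteq> span G"
    using eq_loads_spanning_set[OF fin m ab(2)] .
  have "edge_load p ` B \<subseteq> span G"
    using B(2) G(3) edge_load_in_eq_loads[OF fin, of _ p] by blast
  then have "span G \<subseteq> span (edge_load p ` B)"
    using indep_family_spans[OF B(1,3) G(1)] B(4) G(2) by linarith
  also have "\<dots> \<subseteq> span D"
    using B(2) assms(4) by (intro span_minimal) auto
  finally show ?thesis using G(3) by blast
qed

lemma indep_if_edge_not_spanned:
  assumes E: "simple_graph V E" and v: "v \<in> V - T"
    and N: "nbrs E v = {x, y, z}" "card {x, y, z} = 3" "card ({x, y, z} \<inter> T) \<le> 1"
    and F: "indep_family {e \<in> E. v \<notin> e} (edge_load p)"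
    and xy: "edge_load p {x, y} \<notin> span (edge_load p ` {e \<in> E. v \<notin> e})"
  shows "indep_family E (edge_load p)"
proof -
  let ?F = "{e \<in> E. v \<notin> e}"
  have ne: "v \<noteq> x" "v \<noteq> y" "v \<noteq> z" "{x, y, z} \<subseteq> V"
    using nbrsD(1,2)[OF E, of v] N(1) by auto
  have d: "x \<noteq> y" using N(2) by (auto simp: card_insert_if split: if_splits)
  have nF: "{x, y} \<notin> ?F" using xy by (auto intro: span_base)
  then have nE: "{x, y} \<notin> E" using ne by auto
  define q where "q = p(v := (1 / 2) *\<^sub>R (p x + p y))"
  have qv: "q x = p x" "q y = p y" "q z = p z" "q v = (1 / 2) *\<^sub>R (p x + p y)"
    using ne by (auto simp: q_def)
  have coin: "coincident_realisation T t q"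
    using coincident_fun_upd v by (simp add: q_def)
  have "finite ?F" using simple_graphD(2)[OF E] by simp
  then have "indep_family (insert {x, y} ?F) (edge_load p)"
    using F nF xy by (rule indep_family_insert)
  moreover have "edge_load q e = edge_load p e" if "e \<in> insert {x, y} ?F" for e
    unfolding q_def using that ne(1,2) d simple_graphD(4)[OF E, of e]
    by (intro edge_load_fun_upd) auto
  ultimately have "indep_family (insert {x, y} ?F) (edge_load q)"
    by (simp only: indep_family_cong[of "insert {x, y} ?F" "edge_load q" "edge_load p"])
  then have "indep_family E (edge_load q)"
    by (rule indep_if_subdivided_edge[OF E N(1,2) _ nE])
      (use qv noncollinear[OF ne(4) N(2,3)] in auto)
  then show ?thesis by (rule independent_if_somewhere[OF E coin])
qed

lemma triangle_spanned_if_dependent: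
  assumes E: "simple_graph V E" and v: "v \<in> V - T"
    and N: "card (nbrs E v) = 3" "card (nbrs E v \<inter> T) \<le> 1"
    and F: "indep_family {e \<in> E. v \<notin> e} (edge_load p)"
    and dep: "\<not> indep_family E (edge_load p)"
  shows "eq_loads p (nbrs E v) \<subseteq> span (edge_load p ` {e \<in> E. v \<notin> e})"
proof (rule eq_loads_subset_if_all_edges)
  fix e assume e: "e \<subseteq> nbrs E v" "card e = 2"
  then obtain x y where xy: "e = {x, y}" "x \<noteq> y" by (auto simp: card_2_iff)
  have "card (nbrs E v - e) = 1"
    using e N(1) nbrsD(3)[OF E, of v] by (subst card_Diff_subset) (auto intro: finite_subset)
  then obtain z where "nbrs E v - e = {z}" by (auto simp: card_1_singleton_iff)
  then have "nbrs E v = {x, y, z}" using e(1) xy(1) by auto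
  then show "edge_load p e \<in> span (edge_load p ` {e \<in> E. v \<notin> e})"
    using indep_if_edge_not_spanned[OF E v, of x y z] N F dep xy by auto
qed (use N nbrsD(1)[OF E, of v] in auto)

text \<open>
  The directions \<open>d\<close> for which the opposite forces \<open>d\<close> and \<open>-d\<close> at \<open>s\<close> and \<open>r\<close> are spanned form a subspace of
  the plane.  If it is proper, \<open>v\<close> can be placed in a direction outside it as seen from \<open>p s\<close>, and off the
  line through \<open>p s\<close> and a third neighbour, since two proper subspaces do not cover the plane.
\<close>

lemma coincident_pair_spanned_if_dependent:
  assumes E: "simple_graph V E" and v: "v \<in> V - T"
    and N: "nbrs E v \<inter> T = {r, s}" "r \<noteq> s" "card (nbrs E v) \<le> 3"
    and F: "indep_family {e \<in> E. v \<notin> e} (edge_load p)"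
    and dep: "\<not> indep_family E (edge_load p)"
  shows "eq_loads p {r, s} \<subseteq> span (edge_load p ` {e \<in> E. v \<notin> e})"
proof (rule ccontr)
  let ?F = "{e \<in> E. v \<notin> e}" and ?w = "\<lambda>d. point_load s d - point_load r d"
  let ?L = "span (edge_load p ` ?F)"
  assume "\<not> eq_loads p {r, s} \<subseteq> ?L"
  then obtain f where f: "f \<in> eq_loads p {r, s}" "f \<notin> ?L" by blast
  have rs: "r \<in> T" "s \<in> T" "r \<in> nbrs E v" "s \<in> nbrs E v" using N(1) by auto
  then have prs: "p r = p s" using coincident unfolding coincident_realisation_def by metis
  have "f r + f s = 0" using eq_loadsD(2)[OF f(1)] N(2) by simp
  then have "f r = - f s" by (simp add: add_eq_0_iff2)
  then have "f = ?w (f s)" using eq_loadsD(1)[OF f(1)] N(2) by (auto simp: fun_eq_iff point_load_def)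
  with f(2) have c: "?w (f s) \<notin> ?L" by simp
  have vn: "v \<noteq> r" "v \<noteq> s" "v \<notin> nbrs E v" using nbrsD(2)[OF E, of v] rs by auto
  have build: "indep_family E (edge_load p)"
    if d: "?w d \<notin> ?L" "indep_family (nbrs E v - {r}) (\<lambda>x. p s + d - p x)" for d
  proof -
    define q where "q = p(v := p s + d)"
    have coin: "coincident_realisation T t q"
      using coincident_fun_upd v by (simp add: q_def)
    have same: "edge_load q e = edge_load p e" if "e \<in> ?F" for e
      unfolding q_def using that simple_graphD(4)[OF E, of e] by (intro edge_load_fun_upd) auto
    have "indep_family E (edge_load q)"
    proof (rule indep_if_coincident_neighbours[OF E, of v q r "nbrs E v - {r}" s])
      show "indep_family ?F (edge_load q)" using F by (simp only: indep_family_cong[of ?F, OF same])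
      show "nbrs E v = insert r (nbrs E v - {r})" using rs by auto
      have "indep_family (nbrs E v - {r}) (\<lambda>x. q v - q x) =
          indep_family (nbrs E v - {r}) (\<lambda>x. p s + d - p x)"
        using vn by (intro indep_family_cong) (auto simp: q_def)
      then show "indep_family (nbrs E v - {r}) (\<lambda>x. q v - q x)" using d(2) by simp
      show "q r = q s" using prs vn by (simp add: q_def)
      have "edge_load q ` ?F = edge_load p ` ?F" using same by (intro image_cong) auto
      then show "point_load s (q v - q s) - point_load r (q v - q s) \<notin> span (edge_load q ` ?F)"
        using d(1) vn by (simp add: q_def)
    qed (use rs N(2) in auto)
    then show ?thesis by (rule independent_if_somewhere[OF E coin])
  qed
  have "card (nbrs E v - {r, s}) \<le> 1"
    using N(2,3) rs nbrsD(3)[OF E, of v] by (simp add: card_Diff_subset)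
  then consider "nbrs E v - {r, s} = {}" | w where "nbrs E v - {r, s} = {w}"
    using nbrsD(3)[OF E, of v] by (metis card_1_singletonE card_0_eq finite_Diff le_eq_less_or_eq less_one)
  then show False
  proof cases
    case 1
    then have "nbrs E v - {r} = {s}" using rs N(2) by auto
    moreover have "f s \<noteq> 0"
    proof
      assume "f s = 0"
      then have "?w (f s) = 0" by (auto simp: fun_eq_iff point_load_def)
      then show False using c span_zero by metis
    qed
    ultimately have "indep_family (nbrs E v - {r}) (\<lambda>x. p s + f s - p x)"
      by (simp add: indep_family_singleton)
    then show False using build c dep by blast
  next
    case (2 w)
    then have w: "nbrs E v - {r} = {s, w}" "w \<noteq> s" "w \<in> V" "w \<notin> T"
      using rs N nbrsD(1)[OF E, of v] by auto
    let ?u = "p w - p s"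
    have u: "?u \<noteq> 0" using distinct_points[of w s] w rs T_subset by auto
    define n :: "real ^ 2" where "n = vector [- (?u $ 2), ?u $ 1]"
    have nu: "cross2 n ?u \<noteq> 0"
    proof
      assume "cross2 n ?u = 0"
      moreover have "cross2 n ?u = - ((?u $ 1)\<^sup>2 + (?u $ 2)\<^sup>2)"
        by (simp add: n_def cross2_def power2_eq_square algebra_simps)
      ultimately have "(?u $ 1)\<^sup>2 + (?u $ 2)\<^sup>2 = 0" by linarith
      then have "?u $ 1 = 0 \<and> ?u $ 2 = 0" by (simp only: sum_power2_eq_zero_iff)
      then show False using u by (simp add: vec2_eq_iff)
    qed
    have ok: "indep_family (nbrs E v - {r}) (\<lambda>x. p s + d - p x)" if "cross2 d ?u \<noteq> 0" for d
    proof -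
      have "cross2 (p s + d - p s) (p s + d - p w) \<noteq> 0"
        using that by (simp add: cross2_def algebra_simps)
      then show ?thesis unfolding w(1) by (rule indep_family_pair)
    qed
    have sum: "?w (a + b) = ?w a + ?w b" for a b by (auto simp: fun_eq_iff point_load_def)
    \<comment> \<open>\<open>f s\<close> avoids the subspace and \<open>n\<close> avoids the line; if neither avoids both, their sum does.\<close>
    consider "cross2 (f s) ?u \<noteq> 0" | "?w n \<notin> ?L" | "cross2 (f s) ?u = 0" "?w n \<in> ?L" by blast
    then show False
    proof cases
      case 3
      have "?w (f s + n) \<notin> ?L"
      proof
        assume "?w (f s + n) \<in> ?L"
        then have "?w (f s + n) - ?w n \<in> ?L" using 3(2) by (rule span_diff)
        then show False using c by (simp only: sum add_diff_cancel_right')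
      qed
      moreover have "cross2 (f s + n) ?u \<noteq> 0"
        using 3(1) nu by (simp add: cross2_def algebra_simps)
      ultimately show False using build ok dep by blast
    qed (use build ok nu c dep in blast)+
  qed
qed

end

section \<open>Loads resolved by an edge set\<close>

text \<open>
  A circuit spans no more than what is left of it after removing one element, and the remaining
  elements are independent, so there are enough of them to fill \<open>span G\<close>.
\<close>

lemma circuit_spans:
  assumes "finite C" "\<And>D. D \<subset> C \<Longrightarrow> indep_family D g" "finite G" "g ` C \<subseteq> span G" "card G < card C"
  shows "span G \<subseteq> span (g ` C)"
proof -
  obtain e where e: "e \<in> C" using assms(5) by fastforce
  have "span G \<subseteq> span (g ` (C - {e}))"
    using assms e by (intro indep_family_spans) auto
  also have "\<dots> \<subseteq> span (g ` C)" by (intro span_mono) auto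
  finally show ?thesis .
qed

lemma edge_loads_span_vanish:
  assumes "\<And>e. e \<in> F \<Longrightarrow> v \<notin> e" "f \<in> span (edge_load p ` F)"
  shows "f v = 0"
proof -
  have "subspace {f. f v = (0 :: real ^ 2)}" by (auto simp: subspace_def)
  moreover have "edge_load p ` F \<subseteq> {f. f v = 0}" using assms(1) by (auto simp: edge_load_outside)
  ultimately have "span (edge_load p ` F) \<subseteq> {f. f v = 0}" by (rule span_minimal[rotated])
  with assms(2) show ?thesis by auto
qed

lemma strongly_sparse_mono:
  assumes "finite E" "F \<subseteq> E" "strongly_sparse V E T"
  shows "strongly_sparse V F T"
proof -
  have "induced_edges F X \<le> induced_edges E X" for X
    unfolding induced_edges_def using assms(1,2) by (intro card_mono) auto
  moreover have "family_induced_edges F \<H> \<le> family_induced_edges E \<H>" for \<H>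
    unfolding family_induced_edges_def using assms(1,2) by (intro card_mono) auto
  ultimately show ?thesis
    using assms(3) unfolding strongly_sparse_def S_sparse_def by (meson of_nat_mono order_trans)
qed

context generic_coincident_framework
begin

lemma coincident_subset: "S \<subseteq> T \<Longrightarrow> s \<in> T \<Longrightarrow> coincident_realisation S s p"
  using coincident_realisation_subset[OF coincident] .

lemma distinct_points_if_not_subset:
  assumes "X \<subseteq> V" "2 \<le> card X" "\<not> X \<subseteq> T"
  obtains a b where "a \<in> X" "b \<in> X" "p a \<noteq> p b"
proof -
  obtain a where a: "a \<in> X" "a \<notin> T" using assms(3) by blast
  have "\<not> X \<subseteq> {a}"
  proof
    assume "X \<subseteq> {a}"
    then have "card X \<le> card {a}" by (intro card_mono) auto
    with assms(2) show False by simp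
  qed
  then obtain b where "b \<in> X" "b \<noteq> a" by blast
  with a assms(1) have "p a \<noteq> p b" by (intro distinct_points) auto
  with a \<open>b \<in> X\<close> show ?thesis using that by blast
qed

text \<open>
  Every vertex of \<open>X\<close> carries a nonzero force in some equilibrium load on \<open>X\<close>, namely the load of a
  pair of vertices that \<open>p\<close> separates, whereas the rows of \<open>F\<close> vanish outside \<open>U\<close>.
\<close>

lemma resolved_set_subset:
  assumes "X \<subseteq> V" "a \<in> X" "b \<in> X" "p a \<noteq> p b"
    and "eq_loads p X \<subseteq> span (edge_load p ` F)" "\<And>e. e \<in> F \<Longrightarrow> e \<subseteq> U"
  shows "X \<subseteq> U"
proof
  fix x assume x: "x \<in> X"
  have fin: "finite X" using assms(1) finite_V by (rule finite_subset)
  obtain y where y: "y \<in> X" "p x \<noteq> p y" using assms(2-4) by metis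
  then have xy: "x \<noteq> y" by auto
  have "edge_load p {x, y} \<in> eq_loads p X"
    using fin x y(1) xy by (intro edge_load_in_eq_loads) auto
  then have mem: "edge_load p {x, y} \<in> span (edge_load p ` F)" using assms(5) by blast
  show "x \<in> U"
  proof (rule ccontr)
    assume "x \<notin> U"
    then have "edge_load p {x, y} x = 0"
      using assms(6) by (intro edge_loads_span_vanish[OF _ mem]) auto
    then show False using y(2) by (simp add: edge_load_endpoint[OF xy])
  qed
qed

text \<open>
  The vertices of \<open>S - {s}\<close> carry no force of the loads of \<open>B\<close>, so the loads moving a force from
  there to \<open>s\<close> are independent of them.
\<close>

lemma card_le_with_coincident_loads:
  assumes "finite B" "finite F" "indep_family B (edge_load p)" "edge_load p ` B \<subseteq> span (edge_load p ` F)"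
    and "S \<subseteq> T" "s \<in> S" "eq_loads p S \<subseteq> span (edge_load p ` F)"
    and "\<And>e. e \<in> B \<Longrightarrow> e \<inter> (S - {s}) = {}"
  shows "card B + 2 * (card S - 1) \<le> card F"
proof -
  have finS: "finite S" using assms(5) T_subset finite_V by (meson finite_subset)
  define J where "J = (S - {s}) \<times> (UNIV :: 2 set)"
  define g :: "'v set + 'v \<times> 2 \<Rightarrow> 'v \<Rightarrow> real ^ 2" where
    "g = case_sum (edge_load p) (\<lambda>(x, i). point_load x (axis i 1) - point_load s (axis i 1))"
  have finJ: "finite J" using finS by (simp add: J_def)
  have "indep_family (B <+> J) g"
  proof (rule indep_familyI)
    fix a k assume "(\<Sum>k\<in>B <+> J. a k *\<^sub>R g k) = 0" and k: "k \<in> B <+> J"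
    then have sum: "(\<Sum>e\<in>B. a (Inl e) *\<^sub>R edge_load p e) +
        (\<Sum>(x, i)\<in>J. a (Inr (x, i)) *\<^sub>R (point_load x (axis i 1) - point_load s (axis i 1))) = 0"
      using assms(1) finJ by (simp add: sum.Plus g_def case_prod_unfold)
    have J0: "a (Inr (y, j)) = 0" if y: "y \<in> S - {s}" for y j
    proof -
      have "(\<Sum>e\<in>B. a (Inl e) *\<^sub>R edge_load p e) y = 0"
      proof -
        have "y \<notin> e" if "e \<in> B" for e using assms(8)[OF that] y by blast
        then show ?thesis unfolding sum_apply by (intro sum.neutral) (auto simp: edge_load_outside)
      qed
      then have "0 = (\<Sum>(x, i)\<in>J. a (Inr (x, i)) *\<^sub>R (point_load x (axis i 1) - point_load s (axis i 1))) y"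
        using fun_cong[OF sum, of y] by simp
      also have "\<dots> = (\<Sum>(x, i)\<in>J. if x = y then a (Inr (x, i)) *\<^sub>R axis i 1 else 0)"
        unfolding sum_apply using y by (intro sum.cong) (auto simp: point_load_def)
      also have "\<dots> = (\<Sum>x\<in>S - {s}. \<Sum>i\<in>UNIV. if x = y then a (Inr (x, i)) *\<^sub>R axis i 1 else 0)"
        by (simp add: J_def sum.cartesian_product)
      also have "\<dots> = (\<Sum>x\<in>S - {s}. if x = y then \<Sum>i\<in>UNIV. a (Inr (y, i)) *\<^sub>R axis i 1 else 0)"
        by (intro sum.cong) auto
      also have "\<dots> = (\<Sum>i\<in>UNIV. a (Inr (y, i)) *\<^sub>R (axis i 1 :: real ^ 2))"
        using y finS by (simp add: sum.delta)
      finally have "(\<Sum>i\<in>UNIV. a (Inr (y, i)) *\<^sub>R (axis i 1 :: real ^ 2)) $ j = 0" by simp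
      moreover have "(\<Sum>i\<in>UNIV. a (Inr (y, i)) *\<^sub>R (axis i 1 :: real ^ 2)) $ j =
          (\<Sum>i\<in>UNIV. if i = j then a (Inr (y, i)) else 0)"
        unfolding sum_component by (intro sum.cong) (auto simp: axis_def)
      ultimately show ?thesis by (simp add: sum.delta)
    qed
    then have "(\<Sum>(x, i)\<in>J. a (Inr (x, i)) *\<^sub>R (point_load x (axis i 1) - point_load s (axis i 1))) = 0"
      by (intro sum.neutral) (auto simp: J_def)
    with sum have "(\<Sum>e\<in>B. a (Inl e) *\<^sub>R edge_load p e) = 0" by simp
    then have "a (Inl e) = 0" if "e \<in> B" for e
      using indep_familyD[OF assms(3), of "\<lambda>e. a (Inl e)"] that by blast
    then show "a k = 0" using k J0 by (auto simp: J_def)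
  qed
  moreover have "g ` (B <+> J) \<subseteq> span (edge_load p ` F)"
  proof
    fix f assume "f \<in> g ` (B <+> J)"
    then consider e where "e \<in> B" "f = g (Inl e)" | x i where "(x, i) \<in> J" "f = g (Inr (x, i))"
      by (elim imageE PlusE) auto
    then show "f \<in> span (edge_load p ` F)"
    proof cases
      case (1 e)
      then show ?thesis using assms(4) by (auto simp: g_def)
    next
      case (2 x i)
      then have x: "x \<in> S - {s}" and f: "f = point_load x (axis i 1) - point_load s (axis i 1)"
        by (auto simp: g_def J_def)
      have "p x = p s" using coincident_subset[of S s] assms(5,6) x
        unfolding coincident_realisation_def by blast
      then have "f \<in> eq_loads p S"
        unfolding f using finS assms(6) x by (intro transfer_load_coincident) auto
      then show ?thesis using assms(7) by blast
    qed
  qed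
  ultimately have "card (B <+> J) \<le> card (edge_load p ` F)"
    using assms(1,2) finJ by (intro indep_family_card_le) auto
  also have "\<dots> \<le> card F" using assms(2) by (rule card_image_le)
  finally show ?thesis
    using assms(1,6) finJ finS by (simp add: card_Plus J_def card_cartesian_product)
qed

text \<open>
  Two resolved coincident sets with a common vertex have a resolved union.  A set of maximal
  cardinality thus contains every resolved set that it meets, and with \<open>card T \<le> 3\<close> it meets all those with
  at least two elements unless it is itself a singleton, which contradicts maximality.
\<close>

lemma largest_coincident_resolved_set:
  assumes "card T \<le> 3"
  obtains S where "S \<subseteq> T" "S \<noteq> {}" "eq_loads p S \<subseteq> span (edge_load p ` F)"
    "\<forall>S'. S' \<subseteq> T \<longrightarrow> 2 \<le> card S' \<longrightarrow> eq_loads p S' \<subseteq> span (edge_load p ` F) \<longrightarrow> S' \<subseteq> S"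
proof -
  let ?P = "\<lambda>S. S \<subseteq> T \<and> S \<noteq> {} \<and> eq_loads p S \<subseteq> span (edge_load p ` F)"
  have finT: "finite T" using T_subset finite_V by (rule finite_subset)
  have "eq_loads p {t} \<subseteq> {0}" by (auto simp: eq_loads_def fun_eq_iff)
  then have "?P {t}" using t_in_T span_zero by auto
  moreover have "\<forall>S. ?P S \<longrightarrow> card S < Suc (card T)"
    using finT by (auto simp: less_Suc_eq_le intro: card_mono)
  ultimately obtain S where S: "?P S" and max: "\<And>S'. ?P S' \<Longrightarrow> card S' \<le> card S"
    using ex_has_greatest_nat[of ?P "{t}" card "Suc (card T)"] by metis
  have finS: "finite S" using S finT by (meson finite_subset)
  have largest: "\<forall>S'. S' \<subseteq> T \<longrightarrow> 2 \<le> card S' \<longrightarrow> eq_loads p S' \<subseteq> span (edge_load p ` F) \<longrightarrow> S' \<subseteq> S"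
  proof (intro allI impI)
    fix S' assume S': "S' \<subseteq> T" "2 \<le> card S'" "eq_loads p S' \<subseteq> span (edge_load p ` F)"
    have finS': "finite S'" using S'(1) finT by (rule finite_subset)
    have ne: "S' \<noteq> {}" using S'(2) by auto
    have "S \<inter> S' \<noteq> {}"
    proof
      assume "S \<inter> S' = {}"
      then have "card (S \<union> S') = card S + card S'" using finS finS' by (rule card_Un_disjoint[rotated 2])
      moreover have "card (S \<union> S') \<le> card T" using S S'(1) finT by (intro card_mono) auto
      moreover have "2 \<le> card S" using max[of S'] S' ne by simp
      ultimately show False using assms S'(2) by linarith
    qed
    then obtain s where s: "s \<in> S" "s \<in> S'" by blast
    have "coincident_realisation S' s p" using coincident_subset S'(1) s(2) by blast
    then have "eq_loads p (S \<union> S') \<subseteq> span (edge_load p ` F)"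
      using eq_loads_union_coincident[OF finS finS' s] S S'(3) by simp
    then have "card (S \<union> S') \<le> card S" using S S'(1) by (intro max) auto
    then have "S = S \<union> S'" using finS finS' by (intro card_seteq) auto
    then show "S' \<subseteq> S" by blast
  qed
  show thesis by (rule that[OF _ _ _ largest]) (use S in blast)+
qed

end

section \<open>Maximal rigid sets\<close>

text \<open>
  The setting of the induction step: \<open>F\<close> is an independent edge set on \<open>U\<close>, sparsity is known to imply
  independence on \<open>U\<close>, and \<open>S\<close> is the largest coincident set whose loads are all resolved by \<open>F\<close>.
\<close>

locale rigid_decomposition = generic_coincident_framework +
  fixes U S :: "'a set" and F :: "'a set set" and s :: 'a
  assumes U_subset: "U \<subseteq> V"
    and F_graph: "simple_graph V F" and F_on_U: "\<And>e. e \<in> F \<Longrightarrow> e \<subseteq> U"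
    and F_indep: "indep_family F (edge_load p)" and F_sparse: "strongly_sparse V F T"
    and sparse_imp_indep: "\<And>C. simple_graph V C \<Longrightarrow> (\<And>e. e \<in> C \<Longrightarrow> e \<subseteq> U) \<Longrightarrow>
      strongly_sparse V C T \<Longrightarrow> indep_family C (edge_load p)"
    and S_subset: "S \<subseteq> T" and s_in_S: "s \<in> S"
    and S_resolved: "eq_loads p S \<subseteq> span (edge_load p ` F)"
    and S_largest: "\<And>S'. S' \<subseteq> T \<Longrightarrow> 2 \<le> card S' \<Longrightarrow> eq_loads p S' \<subseteq> span (edge_load p ` F) \<Longrightarrow> S' \<subseteq> S"
begin

abbreviation resolved :: "('a \<Rightarrow> real ^ 2) set" where
  "resolved \<equiv> span (edge_load p ` F)"

definition rigid :: "'a set \<Rightarrow> bool" where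
  "rigid X \<longleftrightarrow> X \<subseteq> V \<and> 2 \<le> card X \<and> \<not> X \<subseteq> T \<and> eq_loads p X \<subseteq> resolved"

definition components :: "'a set set" where
  "components = {X. rigid X \<and> (\<forall>Y. rigid Y \<longrightarrow> X \<subseteq> Y \<longrightarrow> X = Y)}"

text \<open>
  All of \<open>S\<close> is represented by the single vertex \<open>s\<close>.  A reduced component then has at most one vertex in
  \<open>T\<close>, so that \<open>p\<close> is generic on it.
\<close>

definition reduced :: "'a set \<Rightarrow> 'a set" where
  "reduced X = X - (S - {s})"

lemma finite_subset_V: "X \<subseteq> V \<Longrightarrow> finite X"
  using finite_V by (rule rev_finite_subset)

lemma finite_S: "finite S"
  using S_subset T_subset by (intro finite_subset_V) auto

lemma rigid_subset_U: "rigid X \<Longrightarrow> X \<subseteq> U"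
  using distinct_points_if_not_subset[of X] resolved_set_subset[of X _ _ F U] F_on_U
  unfolding rigid_def by metis

lemma finite_components: "finite components"
  using finite_subset[of components "Pow V"] finite_V by (auto simp: components_def rigid_def)

lemma rigid_in_component:
  assumes "rigid X"
  obtains M where "M \<in> components" "X \<subseteq> M"
proof -
  have "finite {X. rigid X}"
    using finite_subset[of "{X. rigid X}" "Pow V"] finite_V by (auto simp: rigid_def)
  from finite_has_maximal2[OF this, of X] assms obtain M where
    "rigid M" "X \<subseteq> M" "\<forall>Y. rigid Y \<longrightarrow> M \<subseteq> Y \<longrightarrow> M = Y" by auto
  then show ?thesis using that unfolding components_def by blast
qed

lemma rigid_union:
  assumes "rigid X" "rigid Y" "a \<in> X \<inter> Y" "b \<in> X \<inter> Y" "p a \<noteq> p b"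
  shows "rigid (X \<union> Y)"
proof -
  have fin: "finite X" "finite Y" using assms(1,2) finite_subset_V by (auto simp: rigid_def)
  have "eq_loads p (X \<union> Y) \<subseteq> resolved"
    using eq_loads_union_two_points[OF fin assms(3-5) subspace_span] assms(1,2) by (simp add: rigid_def)
  moreover have "card X \<le> card (X \<union> Y)" using fin by (intro card_mono) auto
  ultimately show ?thesis using assms(1,2) unfolding rigid_def by auto
qed

lemma component_unique:
  assumes "M \<in> components" "rigid X" "a \<in> M \<inter> X" "b \<in> M \<inter> X" "p a \<noteq> p b"
  shows "X \<subseteq> M"
proof -
  have "rigid (M \<union> X)" using rigid_union[of M X a b] assms by (simp add: components_def)
  then have "M = M \<union> X" using assms(1) unfolding components_def by blast
  then show ?thesis by blast
qed

lemma component_contains_S: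
  assumes M: "M \<in> components" and "r \<in> M" "r \<in> S"
  shows "S \<subseteq> M"
proof -
  have r: "rigid M" using M by (simp add: components_def)
  then have fin: "finite M" using finite_subset_V by (simp add: rigid_def)
  have "coincident_realisation S r p" using coincident_subset S_subset assms(3) by blast
  then have "eq_loads p (M \<union> S) \<subseteq> resolved"
    using eq_loads_union_coincident[OF fin finite_S assms(2,3)] r S_resolved by (simp add: rigid_def)
  moreover have "card M \<le> card (M \<union> S)" using fin finite_S by (intro card_mono) auto
  ultimately have "rigid (M \<union> S)" using r S_subset T_subset unfolding rigid_def by auto
  then have "M = M \<union> S" using M unfolding components_def by blast
  then show ?thesis by blast
qed

lemma reduced_meets_T_at_most_once:
  assumes "M \<in> components"
  shows "card (reduced M \<inter> T) \<le> 1"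
proof (cases "2 \<le> card (M \<inter> T)")
  case True
  have r: "rigid M" using assms by (simp add: components_def)
  then have "eq_loads p (M \<inter> T) \<subseteq> eq_loads p M"
    using finite_subset_V by (intro eq_loads_mono) (auto simp: rigid_def)
  then have "eq_loads p (M \<inter> T) \<subseteq> resolved" using r unfolding rigid_def by blast
  then have "M \<inter> T \<subseteq> S" using True by (intro S_largest) auto
  then have "reduced M \<inter> T \<subseteq> {s}" by (auto simp: reduced_def)
  then have "card (reduced M \<inter> T) \<le> card {s}" by (intro card_mono) auto
  then show ?thesis by simp
next
  case False
  have "card (reduced M \<inter> T) \<le> card (M \<inter> T)"
    using T_subset finite_subset_V by (intro card_mono) (auto simp: reduced_def)
  then show ?thesis using False by linarith
qed

lemma reduced_disjoint:
  assumes "M \<in> components" "\<not> S \<subseteq> M"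
  shows "reduced M = M"
  using component_contains_S[OF assms(1)] assms(2) by (auto simp: reduced_def)

lemma card_reduced_S:
  assumes "M \<in> components" "S \<subseteq> M"
  shows "card (reduced M) = card (M - S) + 1"
proof -
  have "reduced M = insert s (M - S)" using assms(2) s_in_S by (auto simp: reduced_def)
  moreover have "finite (M - S)"
    using assms(1) finite_subset_V by (auto simp: components_def rigid_def)
  ultimately show ?thesis using s_in_S by simp
qed

lemma reduced_subset: "M \<in> components \<Longrightarrow> reduced M \<subseteq> V"
  by (auto simp: components_def rigid_def reduced_def)

lemma two_le_card_reduced:
  assumes "M \<in> components"
  shows "2 \<le> card (reduced M)"
proof (cases "S \<subseteq> M")
  case True
  have "finite (M - S)" "M - S \<noteq> {}"
    using assms finite_subset_V S_subset by (auto simp: components_def rigid_def)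
  then have "card (M - S) > 0" by (simp add: card_gt_0_iff)
  then show ?thesis using card_reduced_S[OF assms True] by simp
next
  case False
  then show ?thesis using reduced_disjoint[OF assms] assms by (simp add: components_def rigid_def)
qed

lemma edge_not_in_T:
  assumes "M \<in> components" "e \<subseteq> reduced M" "card e = 2"
  shows "\<not> e \<subseteq> T"
proof
  assume "e \<subseteq> T"
  have "finite (reduced M)" using reduced_subset[OF assms(1)] by (rule finite_subset_V)
  then have "card e \<le> card (reduced M \<inter> T)" using \<open>e \<subseteq> T\<close> assms(2) by (intro card_mono) auto
  then show False using reduced_meets_T_at_most_once[OF assms(1)] assms(3) by simp
qed

lemma component_of_edge_unique:
  assumes "M \<in> components" "e \<subseteq> M" "card e = 2" "\<not> e \<subseteq> T" "rigid X" "e \<subseteq> X"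
  shows "X \<subseteq> M"
proof -
  have "e \<subseteq> V" using assms(1,2) by (auto simp: components_def rigid_def)
  then obtain a b where "a \<in> e" "b \<in> e" "p a \<noteq> p b"
    using distinct_points_if_not_subset[of e] assms(3,4) by auto
  then show ?thesis using component_unique[OF assms(1,5)] assms(2,6) by blast
qed

definition basis :: "'a set \<Rightarrow> 'a set set" where
  "basis M = (SOME B. finite B \<and> (\<forall>e\<in>B. e \<subseteq> reduced M \<and> card e = 2) \<and>
     indep_family B (edge_load p) \<and> card B + 3 = 2 * card (reduced M))"

lemma basis:
  assumes "M \<in> components"
  shows "finite (basis M)" "\<And>e. e \<in> basis M \<Longrightarrow> e \<subseteq> reduced M \<and> card e = 2"
    "indep_family (basis M) (edge_load p)" "card (basis M) + 3 = 2 * card (reduced M)"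
proof -
  have "finite (reduced M)" using reduced_subset[OF assms] by (rule finite_subset_V)
  from someI_ex[OF laman_basis_on_set[OF this reduced_subset[OF assms] two_le_card_reduced[OF assms]
      reduced_meets_T_at_most_once[OF assms]]]
  show "finite (basis M)" "\<And>e. e \<in> basis M \<Longrightarrow> e \<subseteq> reduced M \<and> card e = 2"
    "indep_family (basis M) (edge_load p)" "card (basis M) + 3 = 2 * card (reduced M)"
    unfolding basis_def[symmetric] by blast+
qed

definition bases :: "'a set set" where
  "bases = (\<Union>M\<in>components. basis M)"

lemma finite_bases: "finite bases"
  unfolding bases_def using finite_components basis(1) by blast

lemma bases_edge:
  assumes "e \<in> bases"
  shows "\<exists>M. M \<in> components \<and> e \<in> basis M \<and> e \<subseteq> reduced M \<and> e \<subseteq> M \<and> card e = 2 \<and> \<not> e \<subseteq> T"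
proof -
  obtain M where M: "M \<in> components" "e \<in> basis M" using assms unfolding bases_def by blast
  note e = basis(2)[OF M]
  have "e \<subseteq> M" using e unfolding reduced_def by blast
  then show ?thesis using M e edge_not_in_T[OF M(1)] by blast
qed

lemma bases_resolved: "edge_load p ` bases \<subseteq> resolved"
proof
  fix f assume "f \<in> edge_load p ` bases"
  then obtain e where e: "e \<in> bases" "f = edge_load p e" by blast
  obtain M where M: "M \<in> components" "e \<subseteq> M" "card e = 2" using bases_edge[OF e(1)] by blast
  then have "finite M" "eq_loads p M \<subseteq> resolved"
    using finite_subset_V by (auto simp: components_def rigid_def)
  then show "f \<in> resolved" using edge_load_in_eq_loads[of M e p] M e(2) by blast
qed

text \<open>
  A circuit \<open>C\<close> among the bases is not sparse, and minimality makes it span the loads of the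
  violating set or family.  A violating set is thus rigid and lies in one component, so that \<open>C\<close> is part
  of a single basis.  A violating family, belonging to some \<open>R \<subseteq> T\<close> with at least two vertices, makes \<open>C\<close> span
  the loads on \<open>R\<close>; then \<open>R \<subseteq> S\<close>, but \<open>C\<close> avoids \<open>S - {s}\<close>.
\<close>

lemma bases_indep: "indep_family bases (edge_load p)"
proof (rule ccontr)
  assume "\<not> indep_family bases (edge_load p)"
  then obtain C where C: "C \<subseteq> bases" "\<not> indep_family C (edge_load p)"
    "\<And>D. D \<subset> C \<Longrightarrow> indep_family D (edge_load p)"
    using minimal_dependent_subfamily[OF finite_bases] by metis
  have eC: "\<exists>M. M \<in> components \<and> e \<in> basis M \<and> e \<subseteq> reduced M \<and> e \<subseteq> M \<and> card e = 2 \<and> \<not> e \<subseteq> T"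
    if "e \<in> C" for e
    by (rule bases_edge[OF subsetD[OF C(1) that]])
  have CU: "e \<subseteq> U" if "e \<in> C" for e
    using eC[OF that] rigid_subset_U unfolding components_def by blast
  have C2: "card e = 2" if "e \<in> C" for e using eC[OF that] by blast
  have finC: "finite C" using C(1) finite_bases by (rule finite_subset)
  have gC: "simple_graph V C"
    unfolding simple_graph_def using finite_V C2 CU U_subset by blast
  have ne: "C \<noteq> {}" using C(2) by auto
  have nz: "edge_load p e \<noteq> 0" if e: "e \<in> C" for e
  proof -
    obtain M where M: "M \<in> components" "e \<in> basis M" using eC[OF e] by blast
    show ?thesis by (rule indep_family_nonzero[OF basis(1,3)[OF M(1)] M(2)])
  qed
  have C_res: "span (edge_load p ` C) \<subseteq> resolved"
    using C(1) bases_resolved by (intro span_minimal) auto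
  have Laman: "int (induced_edges C X) \<le> 2 * int (card X) - 3" if X: "X \<subseteq> V" "2 \<le> card X" for X
  proof (rule ccontr)
    assume dense: "\<not> ?thesis"
    let ?D = "{e \<in> C. e \<subseteq> X}"
    have finX: "finite X" using X(1) by (rule finite_subset_V)
    have D: "?D = C"
    proof (rule ccontr)
      assume "?D \<noteq> C"
      then have "indep_family ?D (edge_load p)" by (intro C(3)) auto
      then have "int (induced_edges ?D X) \<le> 2 * int (card X) - 3"
        using finC C2 finX X(2) by (intro indep_imp_induced_edges_le) auto
      moreover have "induced_edges ?D X = induced_edges C X" by (simp add: induced_edges_def)
      ultimately show False using dense by simp
    qed
    obtain e where e: "e \<in> C" using ne by blast
    then have eX: "e \<subseteq> X" using D by blast
    obtain M where M: "M \<in> components" "e \<subseteq> M" "card e = 2" "\<not> e \<subseteq> T" using eC[OF e] by blast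
    have eV: "e \<subseteq> V" using eX X(1) by blast
    obtain a b where ab: "a \<in> e" "b \<in> e" "p a \<noteq> p b"
      using distinct_points_if_not_subset[OF eV _ M(4)] M(3) by auto
    have abX: "a \<in> X" "b \<in> X" using ab eX by auto
    obtain G where G: "finite G" "card G + 3 \<le> 2 * card X" "eq_loads p X \<subseteq> span G"
      using eq_loads_spanning_set[OF finX abX ab(3)] .
    have "edge_load p ` C \<subseteq> span G"
    proof
      fix f assume "f \<in> edge_load p ` C"
      then obtain e where e: "e \<in> C" "f = edge_load p e" by blast
      then have "e \<subseteq> X" using D by blast
      then show "f \<in> span G"
        using edge_load_in_eq_loads[OF finX _ C2[OF e(1)], of p] G(3) e(2) by blast
    qed
    moreover have "card G < card C" using dense G(2) D by (simp add: induced_edges_def)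
    ultimately have "span G \<subseteq> span (edge_load p ` C)" 
      by (intro circuit_spans[OF finC C(3) G(1)])
    then have "eq_loads p X \<subseteq> resolved" using G(3) C_res by blast
    then have rX: "rigid X" using X M(4) eX unfolding rigid_def by blast
    have XM: "X \<subseteq> M" by (rule component_of_edge_unique[OF M rX eX])
    have "C \<subseteq> basis M"
    proof
      fix d assume d: "d \<in> C"
      then obtain N where N: "N \<in> components" "d \<in> basis N" "d \<subseteq> N" "card d = 2" "\<not> d \<subseteq> T"
        using eC by blast
      have "d \<subseteq> M" using d D XM by blast
      then have "M \<subseteq> N"
        using component_of_edge_unique[OF N(1,3,4,5), of M] M(1) by (simp add: components_def)
      then have "M = N" using M(1) N(1) unfolding components_def by blast
      then show "d \<in> basis M" using N(2) by simp
    qed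
    then have "indep_family C (edge_load p)"
      using indep_family_mono[OF basis(1)[OF M(1)] _ basis(3)[OF M(1)]] by blast
    with C(2) show False by simp
  qed
  have "\<not> strongly_sparse V C T" using sparse_imp_indep[OF gC CU] C(2) by blast
  then obtain R where R: "R \<noteq> {}" "R \<subseteq> T" "\<not> S_sparse V C R" unfolding strongly_sparse_def by blast
  have finR: "finite R" using R(2) T_subset finite_subset_V by blast
  have set_ok: "int (induced_edges C X) \<le> set_val R X" if X: "X \<subseteq> V" "2 \<le> card X" for X
  proof (cases "X \<subseteq> R")
    case True
    have "\<not> e \<subseteq> X" if "e \<in> C" for e using eC[OF that] True R(2) by blast
    then have none: "{e \<in> C. e \<subseteq> X} = {}" by blast
    show ?thesis unfolding induced_edges_def none set_val_def using True by simp
  next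
    case False
    then show ?thesis using Laman[OF X] by (simp add: set_val_def)
  qed
  then obtain \<H> where H: "compatible_family V R \<H>" "\<not> int (family_induced_edges C \<H>) \<le> family_val R \<H>"
    using R(3) unfolding S_sparse_def by blast
  have finH: "finite \<H>" using H(1) finite_V finite_subset[of \<H> "Pow V"] by (auto simp: compatible_family_def)
  have memH: "finite H \<and> R \<subset> H" "H \<subseteq> V" if "H \<in> \<H>" for H
    using H(1) that finite_subset_V by (auto simp: compatible_family_def)
  have "card R \<noteq> 0" using R(1) finR by simp
  then consider "card R = 1" | "2 \<le> card R" by linarith
  then show False
  proof cases
    case 1
    have "int (family_induced_edges C \<H>) \<le> int (\<Sum>H\<in>\<H>. induced_edges C H)"
    proof -
      have "{e \<in> C. \<exists>X\<in>\<H>. e \<subseteq> X} = (\<Union>H\<in>\<H>. {e \<in> C. e \<subseteq> H})" by auto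
      then have "family_induced_edges C \<H> \<le> (\<Sum>H\<in>\<H>. induced_edges C H)"
        unfolding family_induced_edges_def induced_edges_def by (simp only: card_UN_le[OF finH])
      then show ?thesis by (simp only: of_nat_le_iff)
    qed
    also have "\<dots> \<le> (\<Sum>H\<in>\<H>. 2 * int (card (H - R)) - 1)"
      unfolding of_nat_sum
    proof (rule sum_mono)
      fix H assume h: "H \<in> \<H>"
      have "card H = card (H - R) + card R"
        using memH[OF h] finR by (metis card_Diff_subset card_mono le_add_diff_inverse2 psubset_imp_subset)
      moreover have "card R < card H" using memH(1)[OF h] by (intro psubset_card_mono) auto
      ultimately show "int (induced_edges C H) \<le> 2 * int (card (H - R)) - 1"
        using Laman[OF memH(2)[OF h]] 1 by simp
    qed
    also have "\<dots> = family_val R \<H>" using 1 by (simp add: family_val_def)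
    finally show False using H(2) by simp
  next
    case 2
    obtain r where r: "r \<in> R" using R(1) by blast
    have coin: "coincident_realisation R r p" using coincident_subset R(2) r by blast
    let ?D = "{e \<in> C. \<exists>X\<in>\<H>. e \<subseteq> X}"
    have D: "?D = C"
    proof (rule ccontr)
      assume "?D \<noteq> C"
      then have indD: "indep_family ?D (edge_load p)" by (intro C(3)) auto
      have gD: "simple_graph V ?D" using gC by (simp add: simple_graph_def)
      have "strongly_sparse V ?D T"
        by (rule indep_imp_strongly_sparse[OF gD T_subset coincident indD])
      then have "int (family_induced_edges ?D \<H>) \<le> family_val R \<H>"
        using H(1) R(1,2) unfolding strongly_sparse_def S_sparse_def by blast
      moreover have "family_induced_edges ?D \<H> = family_induced_edges C \<H>"
        unfolding family_induced_edges_def by (rule arg_cong[of _ _ card]) auto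
      ultimately show False using H(2) by simp
    qed
    obtain G where G: "finite G" "int (card G) \<le> family_val R \<H>" "eq_loads p R \<subseteq> span G"
      "\<forall>H\<in>\<H>. (\<exists>x\<in>H. p x \<noteq> p r) \<longrightarrow> eq_loads p H \<subseteq> span G"
      by (rule family_loads_spanning_set[OF finH memH(1) finR r coin])
    have "edge_load p ` C \<subseteq> span G"
    proof (rule edge_loads_in_family_span[OF gC _ _ nz G(4)])
      show "C \<subseteq> ?D" using D by simp
    qed (use memH(1) in auto)
    moreover have "card G < card C" using H(2) G(2) D by (simp add: family_induced_edges_def)
    ultimately have "span G \<subseteq> span (edge_load p ` C)" 
      by (intro circuit_spans[OF finC C(3) G(1)])
    then have RC: "eq_loads p R \<subseteq> span (edge_load p ` C)" using G(3) by blast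
    then have "R \<subseteq> S" using S_largest[OF R(2) 2] C_res by blast
    obtain x y where xy: "x \<in> R" "y \<in> R" "x \<noteq> y" using two_distinct_elements[OF 2] .
    then obtain z w where z: "z \<in> R" "z \<noteq> s" "w \<in> R" "w \<noteq> z" by metis
    have coin': "coincident_realisation R w p" using coincident_subset R(2) z(3) by blast
    then have "p z = p w" using z(1) unfolding coincident_realisation_def by blast
    then have "point_load z (axis 1 1) - point_load w (axis 1 1) \<in> eq_loads p R"
      using finR z by (intro transfer_load_coincident) auto
    then have "point_load z (axis 1 1) - point_load w (axis 1 1) \<in> span (edge_load p ` C)"
      using RC by blast
    moreover have "z \<notin> e" if "e \<in> C" for e
      using eC[OF that] z(1,2) \<open>R \<subseteq> S\<close> unfolding reduced_def by blast
    ultimately have "(point_load z (axis 1 1) - point_load w (axis 1 1)) z = (0 :: real ^ 2)"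
      by (intro edge_loads_span_vanish[of C])
    then show False using z(4) by (simp add: point_load_def axis_eq_0_iff)
  qed
qed

lemma card_bases: "int (card bases) = (\<Sum>M\<in>components. 2 * int (card (reduced M)) - 3)"
proof -
  have "card bases = (\<Sum>M\<in>components. card (basis M))"
    unfolding bases_def
  proof (rule card_UN_disjoint)
    show "\<forall>M\<in>components. \<forall>N\<in>components. M \<noteq> N \<longrightarrow> basis M \<inter> basis N = {}"
    proof (intro ballI impI)
      fix M N assume MN: "M \<in> components" "N \<in> components" "M \<noteq> N"
      show "basis M \<inter> basis N = {}"
      proof (rule ccontr)
        assume "basis M \<inter> basis N \<noteq> {}"
        then obtain e where e: "e \<in> basis M" "e \<in> basis N" by blast
        note eM = basis(2)[OF MN(1) e(1)] and eN = basis(2)[OF MN(2) e(2)]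
        have "N \<subseteq> M"
          by (rule component_of_edge_unique[OF MN(1), of e])
            (use eM eN edge_not_in_T[OF MN(1), of e] MN(2) in \<open>auto simp: reduced_def components_def\<close>)
        with MN show False unfolding components_def by blast
      qed
    qed
  qed (use finite_components basis(1) in auto)
  then have "int (card bases) = (\<Sum>M\<in>components. int (card (basis M)))" by simp
  also have "\<dots> = (\<Sum>M\<in>components. 2 * int (card (reduced M)) - 3)"
  proof (rule sum.cong[OF refl])
    fix M assume "M \<in> components"
    from basis(4)[OF this] show "int (card (basis M)) = 2 * int (card (reduced M)) - 3" by linarith
  qed
  finally show ?thesis .
qed

lemma edge_in_component:
  assumes "e \<in> F"
  obtains M where "M \<in> components" "e \<subseteq> M"
proof -
  note Fs = simple_graphD[OF F_graph]
  have eV: "e \<subseteq> V" "card e = 2" using Fs(3,4) assms by auto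
  obtain a b where ab: "e = {a, b}" "p a \<noteq> p b"
    using edge_load_nonzero_imp_distinct[OF eV(2) indep_family_nonzero[OF Fs(2) F_indep assms]] .
  have "\<not> e \<subseteq> T"
  proof
    assume "e \<subseteq> T"
    then have "p a = p t" "p b = p t" using ab(1) coincident unfolding coincident_realisation_def by auto
    then show False using ab(2) by metis
  qed
  moreover have "eq_loads p e \<subseteq> resolved"
  proof
    fix f assume "f \<in> eq_loads p e"
    then obtain c where "f = c *\<^sub>R edge_load p e" using eq_loads_pair[of f p a b] ab by metis
    then show "f \<in> resolved" using assms by (simp add: span_base span_scale)
  qed
  ultimately have "rigid e" using eV by (simp add: rigid_def)
  then show ?thesis using rigid_in_component that by blast
qed

definition S_components :: "'a set set" where
  "S_components = {M \<in> components. S \<subseteq> M}"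

text \<open>
  Counting: the bases together with the loads on \<open>S\<close> give a lower bound for the number of edges,
  sparsity gives the same upper bound, so every sparsity inequality used is an equality.
\<close>

lemma components_tight:
  shows "S_components = {} \<Longrightarrow> card S = 1"
    and "family_val S S_components \<le> int (family_induced_edges F S_components)"
    and "M \<in> components - S_components \<Longrightarrow> 2 * int (card M) - 3 \<le> int (induced_edges F M)"
proof -
  note Fs = simple_graphD[OF F_graph]
  let ?H = S_components and ?r = "\<lambda>M. 2 * int (card (reduced M)) - 3"
  have sub: "?H \<subseteq> components" by (auto simp: S_components_def)
  have "e \<inter> (S - {s}) = {}" if "e \<in> bases" for e
    using bases_edge[OF that] unfolding reduced_def by blast
  then have "card bases + 2 * (card S - 1) \<le> card F"
    using card_le_with_coincident_loads[OF finite_bases Fs(2) bases_indep bases_resolved S_subset s_in_S S_resolved]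
    by blast
  moreover have cS: "card S \<ge> 1"
    using s_in_S finite_S card_gt_0_iff[of S] by (simp add: Suc_le_eq) blast
  ultimately have lower: "(\<Sum>M\<in>components. ?r M) + 2 * (int (card S) - 1) \<le> int (card F)"
    unfolding card_bases[symmetric] by (simp add: of_nat_diff)
  have "F \<subseteq> {e \<in> F. \<exists>X\<in>?H. e \<subseteq> X} \<union> (\<Union>M\<in>components - ?H. {e \<in> F. e \<subseteq> M})"
  proof
    fix e assume e: "e \<in> F"
    obtain M where "M \<in> components" "e \<subseteq> M" by (rule edge_in_component[OF e])
    then show "e \<in> {e \<in> F. \<exists>X\<in>?H. e \<subseteq> X} \<union> (\<Union>M\<in>components - ?H. {e \<in> F. e \<subseteq> M})"
      using e by (cases "M \<in> ?H") auto
  qed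
  then have "card F \<le> card ({e \<in> F. \<exists>X\<in>?H. e \<subseteq> X} \<union> (\<Union>M\<in>components - ?H. {e \<in> F. e \<subseteq> M}))"
    using Fs(2) finite_components by (intro card_mono) auto
  also have "\<dots> \<le> card {e \<in> F. \<exists>X\<in>?H. e \<subseteq> X} + card (\<Union>M\<in>components - ?H. {e \<in> F. e \<subseteq> M})"
    by (rule card_Un_le)
  also have "card (\<Union>M\<in>components - ?H. {e \<in> F. e \<subseteq> M}) \<le> (\<Sum>M\<in>components - ?H. card {e \<in> F. e \<subseteq> M})"
    using finite_components by (intro card_UN_le) auto
  finally have "card F \<le> family_induced_edges F ?H + (\<Sum>M\<in>components - ?H. induced_edges F M)"
    by (simp add: family_induced_edges_def induced_edges_def)
  then have upper: "int (card F) \<le> int (family_induced_edges F ?H) + (\<Sum>M\<in>components - ?H. int (induced_edges F M))"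
    by (metis of_nat_add of_nat_mono of_nat_sum)
  have split: "(\<Sum>M\<in>components. ?r M) = (\<Sum>M\<in>components - ?H. ?r M) + (\<Sum>M\<in>?H. ?r M)"
    using sum.subset_diff[OF sub finite_components] .
  have valH: "family_val S ?H = (\<Sum>M\<in>?H. ?r M) + 2 * (int (card S) - 1)"
    unfolding family_val_def using card_reduced_S sub
    by (intro arg_cong2[of _ _ _ _ "(+)"] sum.cong) (auto simp: S_components_def)
  have S_sp: "S_sparse V F S" using F_sparse S_subset s_in_S unfolding strongly_sparse_def by blast
  have each: "int (induced_edges F M) \<le> ?r M" "reduced M = M" if "M \<in> components - ?H" for M
  proof -
    have M: "M \<in> components" "\<not> S \<subseteq> M" using that by (auto simp: S_components_def)
    show red: "reduced M = M" using reduced_disjoint M .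
    have "M \<subseteq> V" "2 \<le> card M" "\<not> M \<subseteq> S"
      using M(1) S_subset by (auto simp: components_def rigid_def)
    then have "int (induced_edges F M) \<le> set_val S M" using S_sp unfolding S_sparse_def by blast
    then show "int (induced_edges F M) \<le> ?r M" using \<open>\<not> M \<subseteq> S\<close> by (simp add: set_val_def red)
  qed
  have famH: "int (family_induced_edges F ?H) \<le> family_val S ?H" if "?H \<noteq> {}"
  proof -
    have "compatible_family V S ?H"
      using that S_subset by (auto simp: compatible_family_def S_components_def components_def rigid_def)
    then show ?thesis using S_sp unfolding S_sparse_def by blast
  qed
  have fam0: "int (family_induced_edges F ?H) = 0 \<and> (\<Sum>M\<in>?H. ?r M) = 0" if "?H = {}"
    unfolding that by (simp add: family_induced_edges_def)
  have sums: "(\<Sum>M\<in>components - ?H. int (induced_edges F M)) \<le> (\<Sum>M\<in>components - ?H. ?r M)"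
    using each(1) by (rule sum_mono)
  show S1: "card S = 1" if "?H = {}"
  proof -
    have arith: "a + 2 * (k - 1) \<le> f \<Longrightarrow> f \<le> g + x \<Longrightarrow> a = y + z \<Longrightarrow> x \<le> y \<Longrightarrow> g = 0 \<Longrightarrow> z = 0 \<Longrightarrow> k \<le> 1"
      for a f g k x y z :: int by presburger
    have "int (card S) \<le> 1"
      by (rule arith[OF lower upper split sums fam0[OF that, THEN conjunct1] fam0[OF that, THEN conjunct2]])
    then show ?thesis using cS by simp
  qed
  show "family_val S ?H \<le> int (family_induced_edges F ?H)"
    using lower upper split sums valH by linarith
  assume M: "M \<in> components - ?H"
  have "(\<Sum>M\<in>components - ?H. ?r M) \<le> (\<Sum>M\<in>components - ?H. int (induced_edges F M))"
  proof (cases "?H = {}")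
    case True
    note fam0[OF True, THEN conjunct1] fam0[OF True, THEN conjunct2]
    moreover have "(\<Sum>M\<in>components. ?r M) \<le> int (card F)" using lower S1[OF True] by simp
    ultimately show ?thesis using upper split by linarith
  next
    case False
    show ?thesis using lower upper split famH[OF False] valH by linarith
  qed
  then have "(\<Sum>M\<in>components - ?H. ?r M - int (induced_edges F M)) \<le> 0"
    unfolding sum_subtractf by linarith
  moreover have "?r M - int (induced_edges F M) \<le> (\<Sum>M\<in>components - ?H. ?r M - int (induced_edges F M))"
    using M finite_components each(1) by (intro member_le_sum) auto
  ultimately show "2 * int (card M) - 3 \<le> int (induced_edges F M)" using each(2)[OF M] by simp
qed

end

section \<open>Sparse edge sets are independent\<close>

lemma card_edges_with_star:
  assumes "finite A" "\<And>e. e \<in> A \<Longrightarrow> v \<notin> e" "finite N" "v \<notin> N" "finite B" "A \<subseteq> B" "(\<lambda>x. {v, x}) ` N \<subseteq> B"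
  shows "card A + card N \<le> card B"
proof -
  have "inj_on (\<lambda>x. {v, x}) N" by (auto simp: inj_on_def doubleton_eq_iff)
  then have "card A + card N = card (A \<union> (\<lambda>x. {v, x}) ` N)"
    using assms by (subst card_Un_disjoint) (auto simp: card_image)
  also have "\<dots> \<le> card B" using assms by (intro card_mono) auto
  finally show ?thesis .
qed

context rigid_decomposition
begin

text \<open>
  The component containing the three neighbours is tight, or is a member of a tight family.  Enlarging it by
  \<open>v\<close> adds three edges but raises the value only by two.
\<close>

lemma no_star_on_rigid_set:
  assumes E: "simple_graph V E" "strongly_sparse V E T" "F = {e \<in> E. v \<notin> e}"
    and v: "v \<in> V" "v \<notin> U"
    and N: "card (nbrs E v) = 3" "card (nbrs E v \<inter> T) \<le> 1" "eq_loads p (nbrs E v) \<subseteq> resolved"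
  shows False
proof -
  let ?N = "nbrs E v"
  note Ns = nbrsD[OF E(1), of v] and Es = simple_graphD[OF E(1)]
  have "\<not> ?N \<subseteq> T"
  proof
    assume "?N \<subseteq> T"
    then have "?N \<inter> T = ?N" by blast
    then show False using N(1,2) by simp
  qed
  then have "rigid ?N" using Ns(1) N(1,3) by (simp add: rigid_def)
  then obtain M where M: "M \<in> components" "?N \<subseteq> M" by (rule rigid_in_component)
  have rM: "rigid M" using M(1) by (simp add: components_def)
  have vM: "v \<notin> M" using rigid_subset_U[OF rM] v(2) by blast
  have finM: "finite M" and MV: "M \<subseteq> V" and MT: "\<not> M \<subseteq> T"
    using rM finite_subset_V by (auto simp: rigid_def)
  have star: "{v, x} \<in> E" if "x \<in> ?N" for x using that by (simp add: nbrs_def)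
  have F_sub: "e \<in> E \<and> v \<notin> e" if "e \<in> F" for e using that E(3) by blast
  have finE: "finite E" and finF: "finite F" using Es(2) simple_graphD(2)[OF F_graph] by auto
  have S_sp: "S_sparse V E S" using E(2) S_subset s_in_S unfolding strongly_sparse_def by blast
  show False
  proof (cases "M \<in> S_components")
    case False
    have "card {e \<in> F. e \<subseteq> M} + card ?N \<le> card {e \<in> E. e \<subseteq> insert v M}"
    proof (rule card_edges_with_star[of _ v])
      show "{e \<in> F. e \<subseteq> M} \<subseteq> {e \<in> E. e \<subseteq> insert v M}" using F_sub by blast
      show "(\<lambda>x. {v, x}) ` ?N \<subseteq> {e \<in> E. e \<subseteq> insert v M}" using star M(2) by blast
    qed (use F_sub Ns(2,3) finE finF in auto)
    then have "int (induced_edges F M) + 3 \<le> int (induced_edges E (insert v M))"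
      using N(1) by (simp add: induced_edges_def)
    also have "\<dots> \<le> set_val S (insert v M)"
    proof -
      have "2 \<le> card (insert v M)" using rM vM finM by (simp add: rigid_def)
      then show ?thesis using S_sp MV v(1) unfolding S_sparse_def by blast
    qed
    also have "\<dots> = 2 * int (card M) - 1"
      using MT S_subset vM finM by (auto simp: set_val_def)
    finally show False using components_tight(3)[of M] M(1) False by simp
  next
    case True
    let ?H = "insert (insert v M) (S_components - {M})"
    have subU: "H \<subseteq> U" if "H \<in> S_components" for H
      using that rigid_subset_U by (auto simp: S_components_def components_def)
    have comp: "compatible_family V S ?H"
      using True S_subset v(1) MV MT
      by (auto simp: compatible_family_def S_components_def components_def rigid_def)
    have fin: "finite S_components" using finite_components by (simp add: S_components_def)
    have new: "insert v M \<notin> S_components - {M}" using subU v(2) by blast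
    have "card {e \<in> F. \<exists>X\<in>S_components. e \<subseteq> X} + card ?N \<le> card {e \<in> E. \<exists>X\<in>?H. e \<subseteq> X}"
    proof (rule card_edges_with_star[of _ v])
      show "{e \<in> F. \<exists>X\<in>S_components. e \<subseteq> X} \<subseteq> {e \<in> E. \<exists>X\<in>?H. e \<subseteq> X}" using F_sub by blast
      show "(\<lambda>x. {v, x}) ` ?N \<subseteq> {e \<in> E. \<exists>X\<in>?H. e \<subseteq> X}" using star M(2) by blast
    qed (use F_sub Ns(2,3) finE finF in auto)
    then have "int (family_induced_edges F S_components) + 3 \<le> int (family_induced_edges E ?H)"
      using N(1) by (simp add: family_induced_edges_def)
    also have "\<dots> \<le> family_val S ?H" using S_sp comp unfolding S_sparse_def by blast
    also have "\<dots> = family_val S S_components + 2"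
    proof -
      have "v \<notin> S" using True vM by (auto simp: S_components_def)
      then have "insert v M - S = insert v (M - S)" by blast
      then have "card (insert v M - S) = card (M - S) + 1" using vM finM by simp
      then show ?thesis
        using fin new sum.remove[OF fin True, of "\<lambda>H. 2 * int (card (H - S)) - 1"]
        by (simp add: family_val_def)
    qed
    finally show False using components_tight(2) by simp
  qed
qed

text \<open>
  By maximality both neighbours lie in \<open>S\<close>, so the components containing \<open>S\<close> form a tight family.  Adding the
  set \<open>insert v S\<close> to it adds two edges but raises the value only by one.
\<close>

lemma no_star_on_coincident_pair:
  assumes E: "simple_graph V E" "strongly_sparse V E T" "F = {e \<in> E. v \<notin> e}"
    and v: "v \<in> V" "v \<notin> U" "v \<notin> T"
    and N: "{r, q} \<subseteq> nbrs E v" "{r, q} \<subseteq> T" "r \<noteq> q" "eq_loads p {r, q} \<subseteq> resolved"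
  shows False
proof -
  note Ns = nbrsD[OF E(1), of v] and Es = simple_graphD[OF E(1)]
  have rq: "{r, q} \<subseteq> S" using N by (intro S_largest) auto
  then have "card {r, q} \<le> card S" using finite_S by (intro card_mono)
  then have ne: "S_components \<noteq> {}" using components_tight(1) N(3) by auto
  let ?H = "insert (insert v S) S_components"
  have subU: "H \<subseteq> U" if "H \<in> S_components" for H
    using that rigid_subset_U by (auto simp: S_components_def components_def)
  have vS: "v \<notin> S" using v(3) S_subset by blast
  have F_sub: "e \<in> E \<and> v \<notin> e" if "e \<in> F" for e using that E(3) by blast
  have comp: "compatible_family V S ?H"
    using S_subset T_subset v(1) vS
    by (auto simp: compatible_family_def S_components_def components_def rigid_def)
  have fin: "finite S_components" using finite_components by (simp add: S_components_def)
  have new: "insert v S \<notin> S_components" using subU v(2) by blast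
  have S_sp: "S_sparse V E S" using E(2) S_subset s_in_S unfolding strongly_sparse_def by blast
  have "card {e \<in> F. \<exists>X\<in>S_components. e \<subseteq> X} + card {r, q} \<le> card {e \<in> E. \<exists>X\<in>?H. e \<subseteq> X}"
  proof (rule card_edges_with_star[of _ v])
    show "{e \<in> F. \<exists>X\<in>S_components. e \<subseteq> X} \<subseteq> {e \<in> E. \<exists>X\<in>?H. e \<subseteq> X}" using F_sub by blast
    have "{v, x} \<in> {e \<in> E. \<exists>X\<in>?H. e \<subseteq> X}" if "x \<in> {r, q}" for x
    proof -
      have "{v, x} \<in> E" using that N(1) by (auto simp: nbrs_def)
      moreover have "{v, x} \<subseteq> insert v S" using that rq by blast
      ultimately show ?thesis by blast
    qed
    then show "(\<lambda>x. {v, x}) ` {r, q} \<subseteq> {e \<in> E. \<exists>X\<in>?H. e \<subseteq> X}" by (rule image_subsetI)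
    show "v \<notin> {r, q}" using N(1) Ns(2) by blast
  qed (use F_sub Es(2) simple_graphD(2)[OF F_graph] in auto)
  then have "int (family_induced_edges F S_components) + 2 \<le> int (family_induced_edges E ?H)"
    using N(3) by (simp add: family_induced_edges_def)
  also have "\<dots> \<le> family_val S ?H" using S_sp comp unfolding S_sparse_def by blast
  also have "\<dots> = family_val S S_components + 1"
  proof -
    have "insert v S - S = {v}" using vS by blast
    then have "card (insert v S - S) = 1" by simp
    then show ?thesis using fin new by (simp add: family_val_def)
  qed
  finally show False using components_tight(2) by simp
qed

end

lemma sum_degrees:
  assumes "simple_graph V E" "finite U" "\<And>e. e \<in> E \<Longrightarrow> e \<subseteq> U"
  shows "(\<Sum>v\<in>U. card (nbrs E v)) = 2 * card E"
proof -
  note Es = simple_graphD[OF assms(1)]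
  have "(\<Sum>v\<in>U. card (nbrs E v)) = (\<Sum>v\<in>U. \<Sum>e\<in>E. if v \<in> e then 1 else 0)"
    using Es(2) by (intro sum.cong) (auto simp: nbrsD(6)[OF assms(1), symmetric] sum.If_cases Int_def)
  also have "\<dots> = (\<Sum>e\<in>E. \<Sum>v\<in>U. if v \<in> e then 1 else 0)" by (rule sum.swap)
  also have "\<dots> = (\<Sum>e\<in>E. 2)"
  proof (rule sum.cong[OF refl])
    fix e assume e: "e \<in> E"
    then have "U \<inter> {v. v \<in> e} = e" using assms(3) by auto
    then show "(\<Sum>v\<in>U. if v \<in> e then 1 else 0) = (2 :: nat)"
      using assms(2) Es(4)[OF e] by (simp add: sum.If_cases)
  qed
  finally show ?thesis by simp
qed

lemma strongly_sparse_no_edge_in_T: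
  assumes "simple_graph V E" "strongly_sparse V E T" "e \<in> E"
  shows "\<not> e \<subseteq> T"
proof
  assume e: "e \<subseteq> T"
  note Es = simple_graphD[OF assms(1)]
  have "T \<noteq> {}" using e Es(4)[OF assms(3)] by auto
  then have "S_sparse V E T" using assms(2) unfolding strongly_sparse_def by blast
  then have "int (induced_edges E e) \<le> set_val T e"
    using Es(3,4)[OF assms(3)] unfolding S_sparse_def by simp
  then have "card {d \<in> E. d \<subseteq> e} = 0" using e by (simp add: induced_edges_def set_val_def)
  then show False using assms(3) Es(2) by auto
qed

text \<open>
  If \<open>k\<close> vertices outside \<open>T\<close> are joined to all of \<open>T\<close>, the sets consisting of \<open>T\<close> and one of them
  induce \<open>3 * k\<close> edges, while their value is \<open>k + 4\<close>.
\<close>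

lemma few_vertices_joined_to_T:
  assumes E: "simple_graph V E" "strongly_sparse V E T" and T: "T \<subseteq> V" "card T = 3"
    and D: "D \<subseteq> V - T" "\<And>v. v \<in> D \<Longrightarrow> nbrs E v = T"
  shows "card D \<le> 2"
proof (cases "D = {}")
  case False
  note Es = simple_graphD[OF E(1)]
  let ?H = "(\<lambda>v. insert v T) ` D"
  have finT: "finite T" and finD: "finite D" using T(1) D(1) Es(1) by (auto intro: finite_subset)
  have inj: "inj_on (\<lambda>v. insert v T) D" using D(1) by (auto simp: inj_on_def)
  have "card (insert v T - T) = 1" if "v \<in> D" for v
  proof -
    have "insert v T - T = {v}" using that D(1) by blast
    then show ?thesis by simp
  qed
  then have val: "family_val T ?H = int (card D) + 4"
    using T(2) by (simp add: family_val_def sum.reindex[OF inj])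
  have "compatible_family V T ?H"
    unfolding compatible_family_def
  proof (intro conjI ballI)
    fix H assume "H \<in> ?H"
    then obtain v where v: "v \<in> D" "H = insert v T" by blast
    then show "H \<subseteq> V" "T \<subset> H" using T(1) D(1) by blast+
  qed (use False in simp)
  moreover have "T \<noteq> {}" using T(2) by auto
  then have "S_sparse V E T" using E(2) unfolding strongly_sparse_def by blast
  ultimately have "int (family_induced_edges E ?H) \<le> int (card D) + 4"
    using val unfolding S_sparse_def by metis
  moreover have "card (D \<times> T) \<le> family_induced_edges E ?H"
    unfolding family_induced_edges_def
  proof (rule card_inj_on_le)
    show "inj_on (\<lambda>(v, x). {v, x}) (D \<times> T)"
      using D(1) by (auto simp: inj_on_def doubleton_eq_iff)
    show "(\<lambda>(v, x). {v, x}) ` (D \<times> T) \<subseteq> {e \<in> E. \<exists>X\<in>?H. e \<subseteq> X}"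
      using D(2) by (auto simp: nbrs_def)
  qed (use Es(2) in auto)
  ultimately show ?thesis using T(2) by (simp add: card_cartesian_product)
qed simp

context generic_coincident_framework
begin

text \<open>
  Vertices of smaller degree can be removed: dependence would pass to the remaining edges or produce
  one of the two situations excluded above.
\<close>

lemma dependent_imp_large_degree:
  assumes T3: "card T \<le> 3" and U: "U \<subseteq> V" "v \<in> U"
    and E: "simple_graph V E" "\<And>e. e \<in> E \<Longrightarrow> e \<subseteq> U" "strongly_sparse V E T"
    and dep: "\<not> indep_family E (edge_load p)"
    and smaller: "\<And>C. simple_graph V C \<Longrightarrow> (\<And>e. e \<in> C \<Longrightarrow> e \<subseteq> U - {v}) \<Longrightarrow>
      strongly_sparse V C T \<Longrightarrow> indep_family C (edge_load p)"
  shows "if v \<in> T then 3 \<le> card (nbrs E v)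
    else 4 \<le> card (nbrs E v) \<or> card (nbrs E v) = 3 \<and> nbrs E v = T"
proof -
  let ?N = "nbrs E v" and ?F = "{e \<in> E. v \<notin> e}"
  note Es = simple_graphD[OF E(1)] and Ns = nbrsD[OF E(1), of v]
  have finT: "finite T" using T_subset finite_V by (rule finite_subset)
  have vV: "v \<in> V" using U by blast
  have F: "simple_graph V ?F" "strongly_sparse V ?F T" "e \<in> ?F \<Longrightarrow> e \<subseteq> U - {v}" for e
    using E(1,2) strongly_sparse_mono[OF Es(2) _ E(3), of ?F] by (auto simp: simple_graph_def)
  have F_ind: "indep_family ?F (edge_load p)" using smaller F by blast
  have small: "\<not> (card ?N \<le> 2 \<and> card (insert v ?N \<inter> T) \<le> 1)"
    using indep_small_star[OF E(1) vV _ _ F_ind] dep by blast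
  obtain S where S: "S \<subseteq> T" "S \<noteq> {}" "eq_loads p S \<subseteq> span (edge_load p ` ?F)"
    "\<forall>S'. S' \<subseteq> T \<longrightarrow> 2 \<le> card S' \<longrightarrow> eq_loads p S' \<subseteq> span (edge_load p ` ?F) \<longrightarrow> S' \<subseteq> S"
    by (rule largest_coincident_resolved_set[OF T3])
  obtain s where s: "s \<in> S" using S(2) by blast
  interpret rigid_decomposition V T t p "U - {v}" S ?F s
  proof
    show "U - {v} \<subseteq> V" using U(1) by blast
    show "eq_loads p S \<subseteq> span (edge_load p ` ?F)" by (rule S(3))
    show "S' \<subseteq> S" if "S' \<subseteq> T" "2 \<le> card S'" "eq_loads p S' \<subseteq> span (edge_load p ` ?F)" for S'
      using S(4) that by blast
    show "indep_family C (edge_load p)"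
      if "simple_graph V C" "\<And>e. e \<in> C \<Longrightarrow> e \<subseteq> U - {v}" "strongly_sparse V C T" for C
      using that by (rule smaller)
  qed (fact F F_ind S(1) s)+
  show ?thesis
  proof (cases "v \<in> T")
    case True
    have "?N \<inter> T = {}"
    proof (rule ccontr)
      assume "?N \<inter> T \<noteq> {}"
      then obtain x where "{v, x} \<in> E" "x \<in> T" by (auto simp: nbrs_def)
      then show False using strongly_sparse_no_edge_in_T[OF E(1,3)] True by blast
    qed
    then have "insert v ?N \<inter> T = {v}" using True by blast
    then have "\<not> card ?N \<le> 2" using small by simp
    then show ?thesis using True by simp
  next
    case False
    then have vT: "v \<in> V - T" using vV by blast
    have "insert v ?N \<inter> T = ?N \<inter> T" using False by blast
    then have small': "card ?N \<le> 2 \<Longrightarrow> 2 \<le> card (?N \<inter> T)" using small by fastforce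
    have "card ?N = 3 \<and> ?N = T" if le: "card ?N \<le> 3"
    proof -
      have k2: "2 \<le> card (?N \<inter> T)"
      proof (rule ccontr)
        assume "\<not> ?thesis"
        then have c: "card ?N = 3" "card (?N \<inter> T) \<le> 1" using small' le by linarith+
        have "eq_loads p ?N \<subseteq> span (edge_load p ` ?F)"
          by (rule triangle_spanned_if_dependent[OF E(1) vT c F_ind dep])
        then show False using no_star_on_rigid_set[OF E(1,3) refl vV _ c] by blast
      qed
      have k3: "card (?N \<inter> T) \<noteq> 2"
      proof
        assume "card (?N \<inter> T) = 2"
        then obtain r q where rq: "?N \<inter> T = {r, q}" "r \<noteq> q" by (auto simp: card_2_iff)
        have "eq_loads p {r, q} \<subseteq> span (edge_load p ` ?F)"
          by (rule coincident_pair_spanned_if_dependent[OF E(1) vT rq le F_ind dep])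
        then show False
          using no_star_on_coincident_pair[OF E(1,3) refl vV _ False, of r q] rq by blast
      qed
      have "card (?N \<inter> T) \<le> card ?N" "card (?N \<inter> T) \<le> card T"
        using Ns(3) finT by (auto intro: card_mono)
      then have c: "card (?N \<inter> T) = 3" "card ?N = 3" "card T = 3" using k2 k3 le T3 by linarith+
      have "?N \<inter> T = ?N" by (rule card_subset_eq) (use Ns(3) c in auto)
      moreover have "?N \<inter> T = T" by (rule card_subset_eq) (use finT c in auto)
      ultimately show ?thesis using c(2) by metis
    qed
    then show ?thesis using False by auto
  qed
qed

text \<open>
  The sum of the degrees falls short of \<open>4 * card U\<close> by at most one for each vertex in \<open>T\<close> and each of the
  at most two vertices of degree three joined to all of \<open>T\<close>, but sparsity requires it to fall short by six.
\<close>

theorem strongly_sparse_imp_indep: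
  assumes T3: "card T \<le> 3"
    and "U \<subseteq> V" "simple_graph V E" "\<And>e. e \<in> E \<Longrightarrow> e \<subseteq> U" "strongly_sparse V E T"
  shows "indep_family E (edge_load p)"
  using assms(2-)
proof (induction "card U" arbitrary: U E rule: less_induct)
  case less
  note U = less.prems(1) and E = less.prems(2-4)
  note Es = simple_graphD[OF E(1)]
  have finU: "finite U" using U finite_V by (rule finite_subset)
  have finT: "finite T" using T_subset finite_V by (rule finite_subset)
  show ?case
  proof (rule ccontr)
    assume dep: "\<not> indep_family E (edge_load p)"
    have smaller: "indep_family C (edge_load p)"
      if "v \<in> U" "simple_graph V C" "\<And>e. e \<in> C \<Longrightarrow> e \<subseteq> U - {v}" "strongly_sparse V C T" for v C
    proof (rule less.hyps[of "U - {v}"])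
      show "card (U - {v}) < card U" using that(1) finU by (rule card_Diff1_less[rotated])
    qed (use that U in auto)
    note deg = dependent_imp_large_degree[OF T3 U _ E dep smaller]
    define D where "D = {v \<in> U - T. card (nbrs E v) = 3}"
    have D_nbrs: "nbrs E v = T" if "v \<in> D" for v
      using deg[of v] that by (auto simp: D_def)
    have "card D \<le> 2"
    proof (cases "D = {}")
      case False
      then obtain v where v: "v \<in> D" by blast
      then have "card T = 3" using D_nbrs[OF v] by (simp add: D_def)
      have "D \<subseteq> V - T" using U by (auto simp: D_def)
      then show ?thesis
        by (rule few_vertices_joined_to_T[OF E(1,3) T_subset \<open>card T = 3\<close> _ D_nbrs])
    qed simp
    moreover have "card (U \<inter> T) \<le> 3" using T3 finT by (meson card_mono inf_le2 le_trans)
    moreover have "4 * card U \<le> (\<Sum>v\<in>U. card (nbrs E v)) + card (U \<inter> T) + card D"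
    proof -
      have "4 * card U = (\<Sum>v\<in>U. 4)" by simp
      also have "\<dots> \<le> (\<Sum>v\<in>U. card (nbrs E v) + (if v \<in> T then 1 else 0) + (if v \<in> D then 1 else 0))"
        using deg by (intro sum_mono) (force simp: D_def)
      also have "\<dots> = (\<Sum>v\<in>U. card (nbrs E v)) + card (U \<inter> T) + card (U \<inter> D)"
        using finU by (simp add: sum.distrib sum.If_cases Int_def)
      also have "U \<inter> D = D" by (auto simp: D_def)
      finally show ?thesis .
    qed
    moreover have "(\<Sum>v\<in>U. card (nbrs E v)) = 2 * card E"
      by (rule sum_degrees[OF E(1) finU E(2)])
    moreover have "int (card E) \<le> 2 * int (card U) - 3"
    proof -
      have "E \<noteq> {}" using dep by auto
      then obtain e where e: "e \<in> E" by blast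
      then have "card e \<le> card U" using E(2) finU by (intro card_mono) auto
      then have c: "2 \<le> card U" using Es(4)[OF e] by simp
      have "S_sparse V E {t}" using E(3) t_in_T unfolding strongly_sparse_def by blast
      then have "int (induced_edges E U) \<le> set_val {t} U" using U c unfolding S_sparse_def by blast
      moreover have "\<not> U \<subseteq> {t}"
      proof
        assume "U \<subseteq> {t}"
        then have "card U \<le> card {t}" by (intro card_mono) auto
        then show False using c by simp
      qed
      moreover have "{e \<in> E. e \<subseteq> U} = E" using E(2) by blast
      ultimately show ?thesis by (simp add: set_val_def induced_edges_def)
    qed
    ultimately show False by linarith
  qed
qed

end

theorem theorem4p6:
  fixes V T :: "'v set" and E :: "'v set set" and t :: 'v and p :: "'v \<Rightarrow> real ^ 2"
  assumes "simple_graph V E"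
    and "T \<subseteq> V" and "1 \<le> card T" and "card T \<le> 3"
    and "t \<in> T"
    and "generic_coincident_realisation V T t p"
  shows "E \<in> rigidity_matroid V E p \<longleftrightarrow> strongly_sparse V E T"
proof -
  note Es = simple_graphD[OF assms(1)]
  interpret generic_coincident_framework V T t p
    using Es(1) assms by (intro generic_coincident_realisation_framework)
  have "E \<in> rigidity_matroid V E p \<longleftrightarrow> indep_family E (edge_load p)"
    using rows_independent_iff_indep_family[OF Es(3), of E p] by (simp add: rigidity_matroid_def)
  also have "\<dots> \<longleftrightarrow> strongly_sparse V E T"
    using indep_imp_strongly_sparse[OF assms(1,2) coincident]
      strongly_sparse_imp_indep[OF assms(4) order_refl assms(1) Es(3)] by blast
  finally show ?thesis .
qed

end
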